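(* Let $d\ge 2$. The orbits for the action of $AGL(d,2)$ on the Reed-Muller code $RM(2,d)$ are as follows (in each category there is exactly one orbit for each allowed value of $k$): (a) Short sets of defect $k$, for $k=0,\dots,\lfloor \frac d2\rfloor$: these are the codewords of the form $S_1+\dots+S_k$, where the $S_i$ are affine subspaces of codimension $2$ in $\mathbb F_2^d$ with nonempty common intersection which are linearly coindependent with respect to an origin in their common intersection; such a set has cardinality $2^{d-1}-2^{d-k-1}$. (b) Long sets: the complements of short sets (of defect $k$, $k=0,\dots,\lfloor \frac d2\rfloor$). (c) Midsets, of cardinality $2^{d-1}$: these are either affine hyperplanes (defect $0$), or nonaffine midsets of the form $S+H$, where $H$ is an affine hyperplane and $S$ is a short set of cardinality $2^{d-1}-2^{d-k-1}$, for a unique $k\in\{1,\dots,\lfloor \frac{d-1}2\rfloor\}$.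
   Context: $RM(2,d)$ is the binary code (an $\mathbb F_2$-space of subsets of the affine space $\mathbb F_2^d$, with $+$ the Boolean sum, i.e. symmetric difference) spanned by all affine subspaces of codimension $2$. $AGL(d,2)$ acts on it through its natural action on $\mathbb F_2^d$. An affine hyperplane is an affine subspace of codimension 1. A codeword is short, a midset, or long according as its cardinality is less than, equal to, or greater than $2^{d-1}$; a midset is nonaffine if it is not an affine hyperplane. Linear subspaces are coindependent if their annihilators in the dual space are independent (their sum is direct); affine subspaces with nonempty common intersection are coindependent if they are so as linear subspaces after choosing an origin in the common intersection. For $k=0$ the empty sum is the empty codeword. *)

theory Defs
  imports
    "HOL-Analysis.Analysis"
    "HOL-Algebra.Group_Action"
    "HOL-Library.Z2"
begin

text \<open>
  The space $\mathbb{F}_2^d$ is \<^typ>\<open>bit ^ 'd\<close> with $d$ = \<^term>\<open>CARD('d)\<close>.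
\<close>

definition affine_subspace_codim :: "nat \<Rightarrow> (bit ^ 'd) set \<Rightarrow> bool"
  where "affine_subspace_codim c A \<longleftrightarrow>
    (\<exists>a U. vec.subspace U \<and> vec.dim U + c = CARD('d) \<and> A = (\<lambda>x. a + x) ` U)"

definition affine_hyperplane :: "(bit ^ 'd) set \<Rightarrow> bool"
  where "affine_hyperplane H \<longleftrightarrow> affine_subspace_codim 1 H"


text \<open>
  An $\mathbb{F}_2$-linear combination is the same thing as a finite Boolean sum, so the span is
  the closure of the generators and the zero codeword under symmetric difference.
\<close>

inductive_set RM2 :: "(bit ^ 'd) set set"
  where
    zero: "{} \<in> RM2"
  | generator: "affine_subspace_codim 2 A \<Longrightarrow> A \<in> RM2"
  | add: "X \<in> RM2 \<Longrightarrow> Y \<in> RM2 \<Longrightarrow> sym_diff X Y \<in> RM2"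

primrec boolean_sum :: "(nat \<Rightarrow> 'a set) \<Rightarrow> nat \<Rightarrow> 'a set"
  where
    "boolean_sum S 0 = {}"
  | "boolean_sum S (Suc k) = sym_diff (boolean_sum S k) (S (Suc k))"

definition short :: "(bit ^ 'd) set \<Rightarrow> bool"
  where "short X \<longleftrightarrow> card X < 2 ^ (CARD('d) - 1)"

definition midset :: "(bit ^ 'd) set \<Rightarrow> bool"
  where "midset X \<longleftrightarrow> card X = 2 ^ (CARD('d) - 1)"

definition long :: "(bit ^ 'd) set \<Rightarrow> bool"
  where "long X \<longleftrightarrow> card X > 2 ^ (CARD('d) - 1)"


definition AGL :: "(bit ^ 'd \<Rightarrow> bit ^ 'd) monoid"
  where "AGL = \<lparr>carrier = {(\<lambda>x. A *v x + b) | A b. invertible A}, monoid.mult = (\<circ>), one = id\<rparr>"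

text \<open>
  The permutation induced by an affine map on the code. It is restricted to the code because
  \<^const>\<open>BijGroup\<close> consists of extensional functions.
\<close>

definition AGL_action :: "(bit ^ 'd \<Rightarrow> bit ^ 'd) \<Rightarrow> (bit ^ 'd) set \<Rightarrow> (bit ^ 'd) set"
  where "AGL_action g = (\<lambda>X\<in>RM2. g ` X)"


definition annihilator :: "(bit ^ 'd) set \<Rightarrow> (bit ^ 'd \<Rightarrow> bit) set"
  where "annihilator U = {f. Vector_Spaces.linear (*s) (*) f \<and> (\<forall>x\<in>U. f x = 0)}"

text \<open>
  The sum of the annihilators is direct: zero has only the trivial decomposition.
\<close>

definition coindependent :: "'i set \<Rightarrow> ('i \<Rightarrow> (bit ^ 'd) set) \<Rightarrow> bool"
  where "coindependent I U \<longleftrightarrow>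
    (\<forall>f. (\<forall>i\<in>I. f i \<in> annihilator (U i)) \<and> (\<forall>x. (\<Sum>i\<in>I. f i x) = 0)
      \<longrightarrow> (\<forall>i\<in>I. \<forall>x. f i x = 0))"

text \<open>
  For affine subspaces \<open>S i\<close> the translates below are their direction spaces, whichever common
  point \<open>p\<close> is taken as origin. For empty \<open>I\<close> the intersection is the whole space.
\<close>

definition affinely_coindependent :: "'i set \<Rightarrow> ('i \<Rightarrow> (bit ^ 'd) set) \<Rightarrow> bool"
  where "affinely_coindependent I S \<longleftrightarrow>
    (\<exists>p \<in> (\<Inter>i\<in>I. S i). coindependent I (\<lambda>i. (\<lambda>x. x - p) ` S i))"


definition short_sets_of_defect :: "nat \<Rightarrow> (bit ^ 'd) set set"
  where "short_sets_of_defect k =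
    {X. \<exists>S. (\<forall>i\<in>{1..k}. affine_subspace_codim 2 (S i)) \<and>
            affinely_coindependent {1..k} S \<and> X = boolean_sum S k}"

definition long_sets_of_defect :: "nat \<Rightarrow> (bit ^ 'd) set set"
  where "long_sets_of_defect k = uminus ` short_sets_of_defect k"

definition nonaffine_midsets_of_defect :: "nat \<Rightarrow> (bit ^ 'd) set set"
  where "nonaffine_midsets_of_defect k =
    {X \<in> RM2. midset X \<and> \<not> affine_hyperplane X \<and>
      (\<exists>S H. S \<in> RM2 \<and> short S \<and> card S = 2 ^ (CARD('d) - 1) - 2 ^ (CARD('d) - k - 1) \<and>
             affine_hyperplane H \<and> X = sym_diff S H)}"


subsection \<open>The action of the affine group on the code\<close>

lemma affine_map_comp:
  fixes A B :: "bit ^ 'd ^ 'd"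
  shows "(\<lambda>x. A *v x + a) \<circ> (\<lambda>x. B *v x + b) = (\<lambda>x. (A ** B) *v x + (A *v b + a))"
  by (auto simp: fun_eq_iff matrix_vector_mul_assoc matrix_vector_right_distrib add.assoc)

lemma AGL_memI: "invertible A \<Longrightarrow> (\<lambda>x. A *v x + b) \<in> carrier AGL"
  unfolding AGL_def by auto

lemma AGL_inverse:
  fixes g :: "bit ^ 'd \<Rightarrow> bit ^ 'd"
  assumes "g \<in> carrier AGL"
  obtains h where "h \<in> carrier AGL" "h \<circ> g = id"
proof -
  obtain A b where A: "invertible A" and g: "g = (\<lambda>x. A *v x + b)"
    using assms by (auto simp: AGL_def)
  obtain B where B: "A ** B = mat 1" "B ** A = mat 1"
    using A by (auto simp: invertible_def)
  then have "invertible B" by (auto simp: invertible_def)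
  then have h: "(\<lambda>x. B *v x + (- (B *v b))) \<in> carrier AGL"
    by (rule AGL_memI)
  have "(\<lambda>x. B *v x + (- (B *v b))) \<circ> g = id"
    unfolding g affine_map_comp by (simp add: B id_def)
  with h show thesis by (rule that)
qed

lemma group_AGL: "group (AGL :: (bit ^ 'd \<Rightarrow> bit ^ 'd) monoid)"
proof (rule groupI)
  fix x y :: "bit ^ 'd \<Rightarrow> bit ^ 'd"
  assume "x \<in> carrier AGL" "y \<in> carrier AGL"
  then obtain A a B b where *: "invertible A" "invertible B"
      "x = (\<lambda>v. A *v v + a)" "y = (\<lambda>v. B *v v + b)"
    by (auto simp: AGL_def)
  have "invertible (A ** B)" using * by (simp add: invertible_mult)
  then have "x \<circ> y \<in> carrier AGL"
    unfolding *(3,4) affine_map_comp by (rule AGL_memI)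
  then show "x \<otimes>\<^bsub>AGL\<^esub> y \<in> carrier AGL" by (simp add: AGL_def)
next
  have "(\<lambda>x::bit ^ 'd. mat 1 *v x + 0) = id" by auto
  moreover have "invertible (mat 1 :: bit ^ 'd ^ 'd)" by (auto simp: invertible_def)
  ultimately have "id \<in> carrier (AGL :: (bit ^ 'd \<Rightarrow> bit ^ 'd) monoid)"
    using AGL_memI[of "mat 1" 0] by (simp add: id_def)
  then show "\<one>\<^bsub>AGL\<^esub> \<in> carrier (AGL :: (bit ^ 'd \<Rightarrow> bit ^ 'd) monoid)"
    by (simp add: AGL_def)
next
  fix x :: "bit ^ 'd \<Rightarrow> bit ^ 'd"
  assume "x \<in> carrier AGL"
  then obtain h where "h \<in> carrier AGL" "h \<circ> x = id" by (rule AGL_inverse)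
  then show "\<exists>y\<in>carrier AGL. y \<otimes>\<^bsub>AGL\<^esub> x = \<one>\<^bsub>AGL\<^esub>" by (auto simp: AGL_def)
qed (auto simp: AGL_def)

lemma AGL_bij:
  assumes "g \<in> carrier AGL"
  shows "bij g"
proof -
  obtain h where h: "h \<in> carrier AGL" "h \<circ> g = id" using assms by (rule AGL_inverse)
  obtain k where k: "k \<in> carrier AGL" "k \<circ> h = id" using h(1) by (rule AGL_inverse)
  have "k = k \<circ> (h \<circ> g)" using h(2) by simp
  also have "\<dots> = g" using k(2) by (simp flip: comp_assoc)
  finally show ?thesis using h(2) k(2) o_bij[of h g] by simp
qed

lemma AGL_affine_subspace_codim:
  assumes "g \<in> carrier AGL" "affine_subspace_codim c X"
  shows "affine_subspace_codim c (g ` X)"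
proof -
  obtain A b where A: "invertible A" and g: "g = (\<lambda>x. A *v x + b)"
    using assms by (auto simp: AGL_def)
  obtain a U where U: "vec.subspace U" "vec.dim U + c = CARD('a)" "X = (\<lambda>x. a + x) ` U"
    using assms(2) unfolding affine_subspace_codim_def by blast
  have "inj ((*v) A)" using A by (simp add: inj_matrix_vector_mult)
  then have "vec.dim ((*v) A ` U) = vec.dim U"
    by (rule vec.dim_image_eq[OF matrix_vector_mul_linear_gen inj_on_subset[OF _ subset_UNIV]])
  moreover have "vec.subspace ((*v) A ` U)"
    by (rule vec.linear_subspace_image[OF matrix_vector_mul_linear_gen U(1)])
  moreover have "g ` X = (\<lambda>x. (A *v a + b) + x) ` ((*v) A ` U)"
    unfolding U(3) g image_image by (simp add: matrix_vector_right_distrib ac_simps)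
  ultimately show ?thesis using U(2) unfolding affine_subspace_codim_def
    by (intro exI[of _ "A *v a + b"] exI[of _ "(*v) A ` U"]) simp
qed

lemma AGL_RM2:
  assumes g: "g \<in> carrier AGL" and "X \<in> RM2"
  shows "g ` X \<in> RM2"
  using assms(2)
proof induction
  case zero
  show ?case by (simp add: RM2.zero)
next
  case (generator A)
  then show ?case by (intro RM2.generator AGL_affine_subspace_codim[OF g])
next
  case (add X Y)
  have "g ` sym_diff X Y = sym_diff (g ` X) (g ` Y)"
    using AGL_bij[OF g] by (simp add: bij_is_inj image_Un image_set_diff)
  then show ?case using RM2.add[OF add.IH] by simp
qed

lemma group_action_AGL:
  "group_action (AGL :: (bit ^ 'd \<Rightarrow> bit ^ 'd) monoid) RM2 AGL_action"
proof -
  interpret group "AGL :: (bit ^ 'd \<Rightarrow> bit ^ 'd) monoid" by (rule group_AGL)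
  have Bij: "AGL_action g \<in> Bij RM2" if g: "g \<in> carrier AGL" for g :: "bit ^ 'd \<Rightarrow> bit ^ 'd"
  proof -
    obtain h where h: "h \<in> carrier AGL" "h \<circ> g = id" using g by (rule AGL_inverse)
    have "g \<circ> inv_into UNIV g = id" using AGL_bij[OF g] bij_is_surj surj_iff by blast
    with left_right_inverse_eq[OF h(2) this] have "g \<circ> h = id" by simp
    then have "h ` g ` X = X" "g ` h ` X = X" for X
      using h(2) by (simp_all add: image_comp)
    then have "bij_betw (AGL_action g) RM2 RM2"
      using AGL_RM2[OF g] AGL_RM2[OF h(1)]
      by (intro bij_betw_byWitness[where f' = "AGL_action h"]) (simp_all add: AGL_action_def image_subset_iff)
    then show ?thesis by (simp add: Bij_def AGL_action_def)
  qed
  have "AGL_action (x \<circ> y) = compose RM2 (AGL_action x) (AGL_action y)"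
    if "y \<in> carrier AGL" for x y :: "bit ^ 'd \<Rightarrow> bit ^ 'd"
    using AGL_RM2[OF that] by (simp add: AGL_action_def compose_def image_comp fun_eq_iff)
  then have "AGL_action \<in> hom AGL (BijGroup (RM2 :: (bit ^ 'd) set set))"
    using Bij by (auto simp: hom_def BijGroup_def AGL_def)
  then have "group_hom AGL (BijGroup (RM2 :: (bit ^ 'd) set set)) AGL_action"
    by (intro group_hom.intro group_hom_axioms.intro group_AGL group_BijGroup)
  then show ?thesis by (rule group_action.intro)
qed

end

theory Submission
  imports Defs
begin

text \<open>
  A codeword is the set where a polynomial of degree at most \<open>2\<close> takes the value \<open>1\<close>. Write such a
  polynomial as a sum of products of affine functions plus an affine function, with as few products
  as possible. Then the linear parts of all the factors are independent, because a linear relation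
  between them allows one product to be absorbed. If the linear part of the remaining affine
  function lies in their span, translating the factors absorbs it up to a constant, giving a short
  set or the complement of one; otherwise it is one more independent coordinate, giving a midset.
  Any two systems of affine functions with independent linear parts and the same index set are
  conjugate under the affine group, so each normal form is a single orbit. Character sums give
  the cardinalities, and these separate the orbits; for midsets one first adds a hyperplane.
\<close>

section \<open>Affine functions and affinely independent systems\<close>

text \<open>Since \<open>x * x = x\<close> for bits, squares are affine, and the elliptic plane
  \<open>x + x * y + y\<close> equals \<open>(x + 1) * (y + 1) + 1\<close>. So the two types of
  nondegenerate quadratic form do not give separate normal forms beyond a set and its complement.
  The defect k is half the rank of the polar form. Instead of proving that rank invariant, the
  argument recovers k from a cardinality. This fails for midsets, which all have the same size;
  adding a hyperplane leads back to a short set with the same k. Independence is taken modulo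
  constants throughout, because this single notion serves three purposes. A subspace of codimension
  c is the set where c independent affine functions are 1; coindependence of k subspaces of
  codimension 2 is independence of all 2k factors; and the ranges of k express that 2k, respectively
  2k + 1, independent functions fit into d coordinates.\<close>

declare add_bit_eq_xor [simp del] mult_bit_eq_and [simp del]

lemma bit_add_self [simp]: "a + a = 0" for a :: bit
  by (cases a) auto

lemma bit_mult_self [simp]: "a * a = a" for a :: bit
  by (cases a) auto

lemma bit_add_cancel_left [simp]: "a + (a + b) = b" for a b :: bit
  by (cases a; cases b) auto

lemma bit_add_eq_0_iff: "a + b = 0 \<longleftrightarrow> a = b" for a b :: bit
  by (cases a; cases b) auto

lemma bit_mult_eq_1_iff: "a * b = 1 \<longleftrightarrow> a = 1 \<and> b = 1" for a b :: bit
  by (cases a; cases b) auto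

lemma bit_vec_add_self [simp]: "x + x = 0" for x :: "bit ^ 'd"
  by (simp add: vec_eq_iff)

lemma bit_vec_add_cancel [simp]: "x + (x + y) = y" "(y + x) + x = y" for x y :: "bit ^ 'd"
  by (simp_all add: add.assoc flip: add.assoc[of x x])

lemma bit_vec_diff [simp]: "x - y = x + y" for x y :: "bit ^ 'd"
  by (simp add: vec_eq_iff)

lemma CARD_bit [simp]: "CARD(bit) = 2"
proof -
  have UNIV: "(UNIV :: bit set) = {0, 1}" by auto
  show ?thesis unfolding UNIV by simp
qed

lemma finite_bit_vec [simp, intro]: "finite (A :: (bit ^ 'd) set)"
proof -
  have "finite (UNIV :: (bit ^ 'd) set)"
    by (rule card_ge_0_finite) simp
  then show ?thesis by (rule rev_finite_subset) simp
qed

text \<open>Over F_2 additivity already implies linearity, so the condition says that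
  \<open>f\<close> plus the constant \<open>f 0\<close> is linear.\<close>

definition affine_fun :: "(bit ^ 'd \<Rightarrow> bit) \<Rightarrow> bool"
  where "affine_fun f \<longleftrightarrow> (\<forall>x y. f (x + y) = f x + f y + f 0)"

lemma affine_funD: "affine_fun f \<Longrightarrow> f (x + y) = f x + f y + f 0"
  by (simp add: affine_fun_def)

lemma affine_fun_const [simp, intro]: "affine_fun (\<lambda>x. c)"
  by (simp add: affine_fun_def)

lemma affine_fun_nth [simp, intro]: "affine_fun (\<lambda>x. x $ i)"
  by (simp add: affine_fun_def)

lemma affine_fun_add [intro]: "affine_fun f \<Longrightarrow> affine_fun g \<Longrightarrow> affine_fun (\<lambda>x. f x + g x)"
  by (simp add: affine_fun_def ac_simps)

lemma affine_fun_cmult [intro]: "affine_fun f \<Longrightarrow> affine_fun (\<lambda>x. c * f x)"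
  by (cases c) (simp_all add: affine_fun_def)

lemma affine_fun_sum [intro]: "(\<And>i. i \<in> I \<Longrightarrow> affine_fun (f i)) \<Longrightarrow> affine_fun (\<lambda>x. \<Sum>i\<in>I. f i x)"
  by (induction I rule: infinite_finite_induct) auto

lemma affine_fun_expand:
  assumes "affine_fun f"
  shows "f x = f 0 + (\<Sum>i\<in>UNIV. (f (axis i 1) + f 0) * x $ i)"
proof -
  have *: "f (\<Sum>i\<in>I. x $ i *s axis i 1) = f 0 + (\<Sum>i\<in>I. (f (axis i 1) + f 0) * x $ i)" if "finite I" for I
    using that
  proof induction
    case (insert i I)
    have "f (x $ i *s axis i 1) + f 0 = (f (axis i 1) + f 0) * x $ i"
      by (cases "x $ i") (auto simp: vec.scale_one)
    then have "f (x $ i *s axis i 1) = (f (axis i 1) + f 0) * x $ i + f 0"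
      by (metis bit_add_cancel_left add.commute)
    with insert show ?case
      by (simp add: affine_funD[OF assms] ac_simps)
  qed simp
  have "(\<Sum>i\<in>UNIV. x $ i *s axis i 1) = x"
    by (rule basis_expansion)
  with *[of UNIV] show ?thesis by simp
qed

lemma linear_iff_affine_fun:
  "Vector_Spaces.linear (*s) (*) f \<longleftrightarrow> affine_fun f \<and> f 0 = 0" for f :: "bit ^ 'd \<Rightarrow> bit"
proof
  assume "Vector_Spaces.linear (*s) (*) f"
  then interpret Vector_Spaces.linear "(*s)" "(*)" f .
  show "affine_fun f \<and> f 0 = 0" by (simp add: affine_fun_def add)
next
  assume f: "affine_fun f \<and> f 0 = 0"
  show "Vector_Spaces.linear (*s) (*) f"
  proof (intro Vector_Spaces.linear.intro module_hom.intro module_hom_axioms.intro)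
    fix c x show "f (c *s x) = c * f x" using f by (cases c) (auto simp: vec.scale_one)
  qed (use f vec.vector_space_axioms vector_space_over_itself.vector_space_axioms
       vec.module_axioms vector_space_over_itself.module_axioms in \<open>auto simp: affine_funD\<close>)
qed

lemma AGL_affine_fun:
  assumes "g \<in> carrier AGL" "affine_fun f"
  shows "affine_fun (\<lambda>x. f (g x))"
proof -
  obtain A b where g: "g = (\<lambda>x. A *v x + b)" using assms(1) by (auto simp: AGL_def)
  have "g (x + y) = g x + (g y + g 0)" for x y
    by (simp add: g matrix_vector_right_distrib ac_simps flip: add.assoc[of b b])
  then show ?thesis
    using assms(2) by (simp add: affine_fun_def ac_simps)
qed

text \<open>
  Independence modulo constants, i.e. independence of the linear parts when all \<open>u j\<close> are affine.
\<close>

definition affinely_independent :: "'j set \<Rightarrow> ('j \<Rightarrow> bit ^ 'd \<Rightarrow> bit) \<Rightarrow> bool"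
  where "affinely_independent J u \<longleftrightarrow>
    (\<forall>c e. (\<forall>x. (\<Sum>j\<in>J. c j * u j x) = e) \<longrightarrow> (\<forall>j\<in>J. c j = 0))"

definition affine_system :: "'j set \<Rightarrow> ('j \<Rightarrow> bit ^ 'd \<Rightarrow> bit) \<Rightarrow> bool"
  where "affine_system J u \<longleftrightarrow> finite J \<and> (\<forall>j\<in>J. affine_fun (u j)) \<and> affinely_independent J u"

lemma affinely_independentD:
  "affinely_independent J u \<Longrightarrow> (\<And>x. (\<Sum>j\<in>J. c j * u j x) = e) \<Longrightarrow> j \<in> J \<Longrightarrow> c j = 0"
  unfolding affinely_independent_def by blast

lemma affine_systemD:
  assumes "affine_system J u"
  shows "finite J" "affinely_independent J u" "j \<in> J \<Longrightarrow> affine_fun (u j)"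
  using assms by (auto simp: affine_system_def)

lemma affine_system_zero:
  "affine_system J u \<Longrightarrow> (\<And>x. (\<Sum>j\<in>J. c j * u j x) = e) \<Longrightarrow> j \<in> J \<Longrightarrow> c j = 0"
  by (rule affinely_independentD[OF affine_systemD(2)])

lemma affinely_independent_cong:
  "(\<And>j x. j \<in> J \<Longrightarrow> u j x = v j x) \<Longrightarrow> affinely_independent J u \<longleftrightarrow> affinely_independent J v"
  unfolding affinely_independent_def by simp

lemma affine_system_cong:
  assumes "\<And>j x. j \<in> J \<Longrightarrow> u j x = v j x"
  shows "affine_system J u \<longleftrightarrow> affine_system J v"
proof -
  have "u j = v j" if "j \<in> J" for j using assms that by blast
  then show ?thesis using affinely_independent_cong[of J u v, OF assms] unfolding affine_system_def by metis
qed

lemma affine_system_add_const: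
  assumes "affine_system J u"
  shows "affine_system J (\<lambda>j x. u j x + a j)"
proof -
  have "affinely_independent J (\<lambda>j x. u j x + a j)"
    unfolding affinely_independent_def
  proof (intro allI impI)
    fix c e assume "\<forall>x. (\<Sum>j\<in>J. c j * (u j x + a j)) = e"
    then have "(\<Sum>j\<in>J. c j * u j x) = e + (\<Sum>j\<in>J. c j * a j)" for x
      by (auto simp: distrib_left sum.distrib add.commute add.left_commute)
    then show "\<forall>j\<in>J. c j = 0"
      by (intro ballI affine_system_zero[OF assms])
  qed
  then show ?thesis using assms by (auto simp: affine_system_def)
qed

lemma affine_system_reindex:
  assumes "affine_system J u" "inj_on h I" "h ` I \<subseteq> J"
  shows "affine_system I (\<lambda>i. u (h i))"
proof -
  have fin: "finite J" using assms(1) by (simp add: affine_system_def)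
  have "affinely_independent I (\<lambda>i. u (h i))"
    unfolding affinely_independent_def
  proof (intro allI impI ballI)
    fix c e i assume *: "\<forall>x. (\<Sum>i\<in>I. c i * u (h i) x) = e" and i: "i \<in> I"
    \<comment> \<open>The relation on \<open>I\<close>, moved along \<open>h\<close> and extended by
      zero to \<open>J\<close>.\<close>
    define c' where "c' j = (if j \<in> h ` I then c (the_inv_into I h j) else 0)" for j
    have "(\<Sum>j\<in>J. c' j * u j x) = (\<Sum>j\<in>h ` I. c' j * u j x)" for x
      by (rule sum.mono_neutral_right) (use fin assms(3) in \<open>auto simp: c'_def\<close>)
    also have "\<dots> x = (\<Sum>i\<in>I. c i * u (h i) x)" for x
      by (simp add: sum.reindex[OF assms(2)] c'_def the_inv_into_f_f[OF assms(2)])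
    finally have "c' (h i) = 0"
      using i * assms(3) by (intro affine_system_zero[OF assms(1)]) auto
    then show "c i = 0" using i by (simp add: c'_def the_inv_into_f_f[OF assms(2)])
  qed
  moreover have "finite I" using fin assms(2,3) finite_subset inj_on_finite by blast
  ultimately show ?thesis using assms by (auto simp: affine_system_def)
qed

lemma affine_system_subset: "affine_system J u \<Longrightarrow> I \<subseteq> J \<Longrightarrow> affine_system I u"
  using affine_system_reindex[of J u id I] by simp

lemma affine_system_AGL:
  assumes "g \<in> carrier AGL" "affine_system J u"
  shows "affine_system J (\<lambda>j x. u j (g x))"
proof -
  have "affinely_independent J (\<lambda>j x. u j (g x))"
    unfolding affinely_independent_def
  proof (intro allI impI)
    fix c e assume *: "\<forall>x. (\<Sum>j\<in>J. c j * u j (g x)) = e"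
    have "(\<Sum>j\<in>J. c j * u j y) = e" for y
    proof -
      obtain x where "y = g x" using AGL_bij[OF assms(1)] by (metis bij_pointE)
      then show ?thesis using * by simp
    qed
    then show "\<forall>j\<in>J. c j = 0"
      by (intro ballI affine_system_zero[OF assms(2)])
  qed
  then show ?thesis using assms AGL_affine_fun by (auto simp: affine_system_def)
qed

lemma affine_system_coordinates:
  fixes \<phi> :: "'j \<Rightarrow> 'd::finite"
  assumes "inj_on \<phi> J"
  shows "affine_system J (\<lambda>j (x :: bit ^ 'd). x $ \<phi> j)"
proof -
  have "affinely_independent J (\<lambda>j (x :: bit ^ 'd). x $ \<phi> j)"
    unfolding affinely_independent_def
  proof (intro allI impI ballI)
    fix c e j assume *: "\<forall>x :: bit ^ 'd. (\<Sum>j\<in>J. c j * x $ \<phi> j) = e" and j: "j \<in> J"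
    have "e = 0" using *[rule_format, of 0] by simp
    have "finite J" using assms finite finite_imageD by blast
    \<comment> \<open>Evaluating the relation at a basis vector isolates one coefficient.\<close>
    have "(\<Sum>i\<in>J. c i * axis (\<phi> j) 1 $ \<phi> i) = (\<Sum>i\<in>J. if i = j then c i else 0)"
      by (rule sum.cong) (use j assms in \<open>auto simp: axis_def inj_on_def\<close>)
    also have "\<dots> = c j" using \<open>finite J\<close> j by simp
    finally show "c j = 0" using * \<open>e = 0\<close> by simp
  qed
  moreover have "finite J" using assms finite finite_imageD by blast
  ultimately show ?thesis by (simp add: affine_system_def)
qed

section \<open>Affine systems as coordinates of an affine permutation\<close>

lemma invertible_matrix_with_rows:
  fixes a :: "'j \<Rightarrow> 'a::field ^ 'd" and \<phi> :: "'j \<Rightarrow> 'd::finite"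
  assumes inj: "inj_on a J" and ind: "vec.independent (a ` J)" and \<phi>: "inj_on \<phi> J"
  obtains A :: "'a ^ 'd ^ 'd" where "invertible A" "\<And>j. j \<in> J \<Longrightarrow> A $ \<phi> j = a j"
proof -
  \<comment> \<open>The prescribed rows are completed to a basis, and \<open>h\<close> places the
    new basis vectors in the remaining rows. The rows then span, so the matrix is
    invertible.\<close>
  obtain B where B: "a ` J \<subseteq> B" "vec.independent B" "UNIV \<subseteq> vec.span B"
    by (rule vec.maximal_independent_subset_extend[OF subset_UNIV ind])
  have finB: "finite B" using B(2) by (rule vec.finiteI_independent)
  have cardB: "card B = CARD('d)"
    using vec.basis_card_eq_dim[of B UNIV] B by (simp add: vec_dim_card card_cart_basis)
  have "card (B - a ` J) = card (UNIV - \<phi> ` J)"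
    using B finB cardB by (simp add: card_Diff_subset card_image inj \<phi> finite_subset)
  then obtain h where h: "bij_betw h (UNIV - \<phi> ` J) (B - a ` J)"
    using finB by (metis finite_Diff finite_same_card_bij finite)
  define r where "r i = (if i \<in> \<phi> ` J then a (the_inv_into J \<phi> i) else h i)" for i
  have r: "r (\<phi> j) = a j" if "j \<in> J" for j using that by (simp add: r_def the_inv_into_f_f \<phi>)
  define A where "A = (\<chi> i. r i)"
  have "b \<in> range r" if "b \<in> B" for b
  proof (cases "b \<in> a ` J")
    case True
    then obtain j where "j \<in> J" "b = r (\<phi> j)" using r by auto
    then show ?thesis by blast
  next
    case False
    then have "b \<in> h ` (UNIV - \<phi> ` J)"
      using h that by (simp add: bij_betw_imp_surj_on)
    then obtain i where "i \<notin> \<phi> ` J" "b = h i" by auto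
    then show ?thesis by (auto simp: r_def)
  qed
  then have "B \<subseteq> rows A" by (fastforce simp: rows_def row_def A_def vec_lambda_eta)
  then have "vec.span (rows A) = UNIV" using B(3) vec.span_mono by blast
  then have "invertible A"
    using matrix_left_invertible_span_rows_gen[of A] invertible_left_inverse by blast
  moreover have "A $ \<phi> j = a j" if "j \<in> J" for j using r that by (simp add: A_def)
  ultimately show thesis using that by blast
qed

text \<open>A linear relation between the coefficient vectors \<open>a j\<close> is a relation
  between the \<open>u j\<close> up to a constant, which is exactly what
  \<open>affinely_independent\<close> forbids.\<close>

lemma affine_system_linear_parts:
  fixes u :: "'j \<Rightarrow> bit ^ 'd \<Rightarrow> bit"
  assumes u: "affine_system J u"
  obtains a :: "'j \<Rightarrow> bit ^ 'd" where "inj_on a J" "vec.independent (a ` J)"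
    "\<And>j x. j \<in> J \<Longrightarrow> (\<Sum>i\<in>UNIV. a j $ i * x $ i) = u j x + u j 0"
proof -
  have aff: "affine_fun (u j)" if "j \<in> J" for j using u that by (simp add: affine_system_def)
  define a where "a j = (\<chi> i. u j (axis i 1) + u j 0)" for j
  have dot: "(\<Sum>i\<in>UNIV. a j $ i * x $ i) = u j x + u j 0" if "j \<in> J" for j x
    using affine_fun_expand[OF aff[OF that], of x] by (simp add: a_def add.commute)
  have relation: "c j = 0" if c: "(\<Sum>j\<in>J. c j *s a j) = 0" and j: "j \<in> J" for c j
  proof (rule affinely_independentD[where u = u and e = "\<Sum>j\<in>J. c j * u j 0", OF _ _ j])
    fix x
    have "0 = (\<Sum>i\<in>UNIV. (\<Sum>j\<in>J. c j *s a j) $ i * x $ i)" using c by simp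
    also have "\<dots> = (\<Sum>i\<in>UNIV. \<Sum>j\<in>J. c j * (a j $ i * x $ i))"
      by (simp add: sum_distrib_right mult.assoc)
    also have "\<dots> = (\<Sum>j\<in>J. c j * (\<Sum>i\<in>UNIV. a j $ i * x $ i))"
      by (subst sum.swap) (simp add: sum_distrib_left)
    also have "\<dots> = (\<Sum>j\<in>J. c j * u j x) + (\<Sum>j\<in>J. c j * u j 0)"
      by (simp add: dot distrib_left sum.distrib)
    finally show "(\<Sum>j\<in>J. c j * u j x) = (\<Sum>j\<in>J. c j * u j 0)"
      by (metis bit_add_eq_0_iff)
  qed (use u in \<open>simp add: affine_system_def\<close>)
  have finJ: "finite J" using u by (simp add: affine_system_def)
  have inj: "inj_on a J"
  proof (rule inj_onI, rule ccontr)
    fix i j assume ij: "i \<in> J" "j \<in> J" "a i = a j" "i \<noteq> j"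
    \<comment> \<open>Two equal vectors would satisfy the relation with coefficient 1 at both
      indices, because 1 + 1 = 0.\<close>
    let ?c = "\<lambda>k. if k = i \<or> k = j then 1 else 0 :: bit"
    have "(\<Sum>k\<in>J. ?c k *s a k) = (\<Sum>k\<in>{i, j}. ?c k *s a k)"
      by (rule sum.mono_neutral_right) (use ij finJ in auto)
    also have "\<dots> = 0" using ij by simp
    finally show False using relation[of ?c i] ij by simp
  qed
  have ind: "vec.independent (a ` J)"
  proof (rule vec.independent_if_scalars_zero)
    fix f v assume *: "(\<Sum>v\<in>a ` J. f v *s v) = 0" "v \<in> a ` J"
    then have "(\<Sum>j\<in>J. f (a j) *s a j) = 0" by (simp add: sum.reindex[OF inj])
    then show "f v = 0" using *(2) relation[of "\<lambda>j. f (a j)"] by auto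
  qed (use finJ in simp)
  show thesis using that[OF inj ind dot] by simp
qed

text \<open>The source of transitivity: the linear parts become rows of an invertible matrix and the
  values at 0 its translation part, so any system turns into coordinates chosen in advance.\<close>

lemma affine_system_extend_to_AGL:
  fixes u :: "'j \<Rightarrow> bit ^ 'd \<Rightarrow> bit" and \<phi> :: "'j \<Rightarrow> 'd::finite"
  assumes u: "affine_system J u" and \<phi>: "inj_on \<phi> J"
  obtains g where "g \<in> carrier AGL" "\<And>j x. j \<in> J \<Longrightarrow> g x $ \<phi> j = u j x"
proof -
  obtain a where a: "inj_on a J" "vec.independent (a ` J)"
    and dot: "\<And>j x. j \<in> J \<Longrightarrow> (\<Sum>i\<in>UNIV. a j $ i * x $ i) = u j x + u j 0"
    using affine_system_linear_parts[OF u] by metis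
  obtain A where A: "invertible A" "\<And>j. j \<in> J \<Longrightarrow> A $ \<phi> j = a j"
    using invertible_matrix_with_rows[OF a \<phi>] by metis
  define b where "b = (\<chi> i. if i \<in> \<phi> ` J then u (the_inv_into J \<phi> i) 0 else 0)"
  have "(A *v x + b) $ \<phi> j = u j x" if "j \<in> J" for j x
    using that dot[OF that] by (simp add: matrix_vector_mult_def A(2) b_def the_inv_into_f_f[OF \<phi>] ac_simps)
  then show thesis using that[OF AGL_memI[OF A(1), of b]] by simp
qed

text \<open>Applied to 2k or 2k + 1 functions, this bound gives the admissible ranges of the
  defect.\<close>

lemma affine_system_card:
  fixes u :: "'j \<Rightarrow> bit ^ 'd \<Rightarrow> bit"
  assumes u: "affine_system J u"
  shows "card J \<le> CARD('d)"
proof -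
  obtain a :: "'j \<Rightarrow> bit ^ 'd" where a: "inj_on a J" "vec.independent (a ` J)"
    using affine_system_linear_parts[OF u] by metis
  then have "card (a ` J) \<le> vec.dim (UNIV :: (bit ^ 'd) set)"
    by (intro vec.independent_card_le_dim) auto
  then show ?thesis using a by (simp add: card_image vec_dim_card card_cart_basis)
qed

lemma affine_system_surj:
  assumes u: "affine_system J u"
  obtains x where "\<And>j. j \<in> J \<Longrightarrow> u j x = c j"
proof -
  obtain \<phi> :: "'a \<Rightarrow> 'b" where \<phi>: "inj_on \<phi> J"
    using affine_system_card[OF u] affine_systemD(1)[OF u] by (metis card_le_inj finite subset_UNIV)
  obtain g where g: "g \<in> carrier AGL" "\<And>j x. j \<in> J \<Longrightarrow> g x $ \<phi> j = u j x"
    using affine_system_extend_to_AGL[OF u \<phi>] by metis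
  obtain x where x: "(\<chi> i. c (the_inv_into J \<phi> i)) = g x"
    using AGL_bij[OF g(1)] by (metis bij_pointE)
  have "u j x = c j" if "j \<in> J" for j
    using g(2)[OF that, of x] x[symmetric] that by (simp add: the_inv_into_f_f[OF \<phi>])
  then show thesis by (rule that)
qed

text \<open>For the character sums: a translation that flips chosen functions and leaves the others
  alone.\<close>

lemma affine_system_shift:
  assumes u: "affine_system J u"
  obtains t where "\<And>j x. j \<in> J \<Longrightarrow> u j (x + t) = u j x + c j"
proof -
  \<comment> \<open>At this \<open>t\<close> the linear part of \<open>u j\<close> takes the value
    \<open>c j\<close>; the summand \<open>u j 0\<close> removes the constant.\<close>
  obtain t where "\<And>j. j \<in> J \<Longrightarrow> u j t = c j + u j 0"
    using affine_system_surj[OF u, of "\<lambda>j. c j + u j 0"] by metis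
  then have "u j (x + t) = u j x + c j" if "j \<in> J" for j x
    using affine_funD[OF affine_systemD(3)[OF u that], of x t] that by (simp add: add.assoc)
  then show thesis by (rule that)
qed

text \<open>In a nontrivial relation the coefficient of \<open>f\<close> must be 1, since otherwise
  the relation would involve the independent \<open>u j\<close> alone. The fresh index
  \<open>k\<close> is the place of \<open>f\<close> in the enlarged system.\<close>

lemma affine_system_span:
  assumes u: "affine_system J u" and f: "affine_fun f" and k: "k \<notin> J"
    and dep: "\<not> affine_system (insert k J) (u(k := f))"
  obtains c e where "\<And>x. f x = (\<Sum>j\<in>J. c j * u j x) + e"
proof -
  have "\<not> affinely_independent (insert k J) (u(k := f))"
    using dep u f k by (auto simp: affine_system_def split: if_splits)
  then obtain c e i where rel: "\<And>x. (\<Sum>j\<in>insert k J. c j * (u(k := f)) j x) = e"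
    and i: "i \<in> insert k J" "c i = 1"
    unfolding affinely_independent_def by auto
  have "(\<Sum>j\<in>J. c j * (u(k := f)) j x) = (\<Sum>j\<in>J. c j * u j x)" for x
    by (rule sum.cong) (use k in auto)
  then have *: "c k * f x + (\<Sum>j\<in>J. c j * u j x) = e" for x
    using rel[of x] affine_systemD(1)[OF u] k by simp
  have "c k = 1"
  proof (rule ccontr)
    assume "c k \<noteq> 1"
    then have "c k = 0" by simp
    then have "(\<Sum>j\<in>J. c j * u j x) = e" for x using *[of x] by simp
    then have "c i = 0" using i \<open>c k = 0\<close> by (intro affine_system_zero[OF u]) auto
    then show False using i by simp
  qed
  then have "f x = (\<Sum>j\<in>J. c j * u j x) + e" for x
    using *[of x] by (metis add.commute bit_add_cancel_left mult_1)
  then show thesis by (rule that)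
qed

text \<open>If \<open>f\<close> were independent of the \<open>u j\<close>, some point would have
  all \<open>u j\<close> equal to 0 and \<open>f\<close> equal to 1. This is how annihilators of
  common zero sets are computed.\<close>

lemma vanishing_imp_in_span:
  assumes u: "affine_system J u" and f: "affine_fun f" and k: "k \<notin> J"
    and vanish: "\<And>x. (\<And>j. j \<in> J \<Longrightarrow> u j x = 0) \<Longrightarrow> f x = 0"
  obtains c e where "\<And>x. f x = (\<Sum>j\<in>J. c j * u j x) + e"
proof (rule affine_system_span[OF u f k])
  show "\<not> affine_system (insert k J) (u(k := f))"
  proof
    assume "affine_system (insert k J) (u(k := f))"
    then obtain x where x: "\<And>j. j \<in> insert k J \<Longrightarrow> (u(k := f)) j x = (if j = k then 1 else 0)"
      using affine_system_surj[of "insert k J" "u(k := f)" "\<lambda>j. if j = k then 1 else 0"] by metis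
    have "f x = 1" using x[of k] by simp
    moreover have "u j x = 0" if "j \<in> J" for j using x[of j] that k by (auto split: if_splits)
    ultimately show False using vanish[of x] by simp
  qed
qed (rule that)

section \<open>Orbits of sets defined by affine systems\<close>

text \<open>\<open>F\<close> receives total functions, but an affine change of coordinates controls
  the values on \<open>J\<close> only.\<close>

definition depends_only_on :: "'j set \<Rightarrow> (('j \<Rightarrow> bit) \<Rightarrow> bool) \<Rightarrow> bool"
  where "depends_only_on J F \<longleftrightarrow> (\<forall>f g. (\<forall>j\<in>J. f j = g j) \<longrightarrow> F f = F g)"

lemma depends_only_onD:
  "depends_only_on J F \<Longrightarrow> (\<And>j. j \<in> J \<Longrightarrow> f j = g j) \<Longrightarrow> F f \<longleftrightarrow> F g"
  unfolding depends_only_on_def by blast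

text \<open>Common shape of affine subspaces, short sets, long sets and midsets: a fixed Boolean
  condition on the values of a variable independent system. It allows one orbit argument for all of
  them.\<close>

definition affine_class :: "'j set \<Rightarrow> (('j \<Rightarrow> bit) \<Rightarrow> bool) \<Rightarrow> (bit ^ 'd) set set"
  where "affine_class J F = {X. \<exists>u. affine_system J u \<and> X = {x. F (\<lambda>j. u j x)}}"

lemma affine_classI: "affine_system J u \<Longrightarrow> {x. F (\<lambda>j. u j x)} \<in> affine_class J F"
  unfolding affine_class_def by blast

lemma affine_classE:
  assumes "X \<in> affine_class J F"
  obtains u where "affine_system J u" "X = {x. F (\<lambda>j. u j x)}"
  using assms unfolding affine_class_def by blast

lemma uminus_affine_class: "uminus ` affine_class J F = affine_class J (\<lambda>f. \<not> F f)"
proof -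
  have "- {x. F (\<lambda>j. u j x)} = {x. \<not> F (\<lambda>j. u j x)}" for u by auto
  then show ?thesis unfolding affine_class_def image_def by auto
qed

lemma AGL_inverse_both:
  assumes "g \<in> carrier AGL"
  obtains h where "h \<in> carrier AGL" "\<And>x. h (g x) = x" "\<And>x. g (h x) = x"
proof -
  obtain h where h: "h \<in> carrier AGL" "h \<circ> g = id" using assms by (rule AGL_inverse)
  have hg: "h (g x) = x" for x using h(2) by (metis comp_apply id_apply)
  have "g (h x) = x" for x using AGL_bij[OF assms] hg by (metis bij_pointE)
  with h(1) hg show thesis by (rule that)
qed

text \<open>All members are affine images of one model, the set where the coordinates selected by
  \<open>\<phi>\<close> satisfy \<open>F\<close>: for a member given by \<open>u\<close>, an affine
  permutation turns \<open>u\<close> into these coordinates, and its inverse carries the model to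
  the member. Conversely, composing the coordinates with an affine permutation gives an independent
  system again.\<close>

lemma affine_class_orbit:
  fixes F :: "('j \<Rightarrow> bit) \<Rightarrow> bool"
  assumes J: "finite J" "card J \<le> CARD('d)" and F: "depends_only_on J F"
    and RM2: "affine_class J F \<subseteq> (RM2 :: (bit ^ 'd) set set)"
  shows "(affine_class J F :: (bit ^ 'd) set set) \<in> orbits AGL RM2 AGL_action"
proof -
  obtain \<phi> :: "'j \<Rightarrow> 'd" where \<phi>: "inj_on \<phi> J"
    using J by (metis card_le_inj finite subset_UNIV)
  define X\<^sub>0 :: "(bit ^ 'd) set" where "X\<^sub>0 = {x. F (\<lambda>j. x $ \<phi> j)}"
  have X\<^sub>0: "X\<^sub>0 \<in> affine_class J F"
    unfolding X\<^sub>0_def by (rule affine_classI[OF affine_system_coordinates[OF \<phi>]])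
  have X\<^sub>0_RM2: "X\<^sub>0 \<in> RM2" using X\<^sub>0 RM2 by blast
  have "affine_class J F = {g ` X\<^sub>0 | g. g \<in> carrier AGL}"
  proof (intro equalityI subsetI)
    fix X :: "(bit ^ 'd) set"
    assume "X \<in> affine_class J F"
    then obtain u where u: "affine_system J u" "X = {x. F (\<lambda>j. u j x)}" by (rule affine_classE)
    obtain g where g: "g \<in> carrier AGL" "\<And>j x. j \<in> J \<Longrightarrow> g x $ \<phi> j = u j x"
      using affine_system_extend_to_AGL[OF u(1) \<phi>] by metis
    have X: "x \<in> X \<longleftrightarrow> g x \<in> X\<^sub>0" for x
      unfolding X\<^sub>0_def u(2) using depends_only_onD[OF F, of "\<lambda>j. g x $ \<phi> j" "\<lambda>j. u j x"] g(2) by simp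
    obtain h where h: "h \<in> carrier AGL" "\<And>x. h (g x) = x" "\<And>x. g (h x) = x"
      using AGL_inverse_both[OF g(1)] by metis
    have "X = h ` X\<^sub>0"
    proof (intro Set.set_eqI iffI)
      fix x assume "x \<in> X"
      then have "h (g x) \<in> h ` X\<^sub>0" using X by blast
      then show "x \<in> h ` X\<^sub>0" by (simp add: h)
    qed (auto simp: X h)
    then show "X \<in> {g ` X\<^sub>0 | g. g \<in> carrier AGL}" using h(1) by blast
  next
    fix X assume "X \<in> {g ` X\<^sub>0 | g. g \<in> carrier AGL}"
    then obtain g where g: "g \<in> carrier AGL" "X = g ` X\<^sub>0" by blast
    obtain h where h: "h \<in> carrier AGL" "\<And>x. h (g x) = x" "\<And>x. g (h x) = x"
      using AGL_inverse_both[OF g(1)] by metis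
    have "X = {x. h x \<in> X\<^sub>0}"
    proof (intro Set.set_eqI iffI)
      fix x assume "x \<in> {x. h x \<in> X\<^sub>0}"
      then have "g (h x) \<in> g ` X\<^sub>0" by blast
      then show "x \<in> X" by (simp add: h g)
    qed (auto simp: g h)
    then have "X = {x. F (\<lambda>j. h x $ \<phi> j)}" by (simp add: X\<^sub>0_def)
    then show "X \<in> affine_class J F"
      using affine_classI[OF affine_system_AGL[OF h(1) affine_system_coordinates[OF \<phi>]]] by simp
  qed
  also have "\<dots> = orbit AGL AGL_action X\<^sub>0"
    unfolding orbit_def using X\<^sub>0_RM2 by (simp add: AGL_action_def)
  finally show ?thesis unfolding orbits_def using X\<^sub>0_RM2 by blast
qed

lemma affine_class_nonempty:
  fixes F :: "('j \<Rightarrow> bit) \<Rightarrow> bool"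
  assumes J: "finite J" "card J \<le> CARD('d)"
  shows "(affine_class J F :: (bit ^ 'd) set set) \<noteq> {}"
proof -
  obtain \<phi> :: "'j \<Rightarrow> 'd" where \<phi>: "inj_on \<phi> J"
    using J by (metis card_le_inj finite subset_UNIV)
  show ?thesis using affine_classI[OF affine_system_coordinates[OF \<phi>], of F] by blast
qed

section \<open>Affine subspaces as level sets of affine systems\<close>

lemma coordinate_subspace_codim:
  fixes K :: "'d::finite set"
  shows "affine_subspace_codim (card K) {x :: bit ^ 'd. \<forall>i\<in>K. x $ i = 1}"
proof -
  \<comment> \<open>Translation by the all-ones vector exchanges the levels 0 and 1. Level 1 is
    preferred because a product of bits is 1 exactly when all its factors are.\<close>
  define a :: "bit ^ 'd" where "a = (\<chi> i. 1)"
  let ?U = "{x :: bit ^ 'd. \<forall>i. i \<notin> - K \<longrightarrow> x $ i = 0}"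
  have "vec.subspace ?U" by (rule subspace_substandard_cart)
  moreover have "card (- K) + card K = CARD('d)"
    by (simp add: Compl_eq_Diff_UNIV card_Diff_subset card_mono)
  then have "vec.dim ?U + card K = CARD('d)"
    by (simp only: dim_substandard_cart)
  moreover have "{x :: bit ^ 'd. \<forall>i\<in>K. x $ i = 1} = (\<lambda>x. a + x) ` ?U"
  proof (intro Set.set_eqI iffI)
    fix x :: "bit ^ 'd" assume "x \<in> {x. \<forall>i\<in>K. x $ i = 1}"
    then have "a + x \<in> ?U" by (simp add: a_def)
    then have "a + (a + x) \<in> (\<lambda>x. a + x) ` ?U" by blast
    then show "x \<in> (\<lambda>x. a + x) ` ?U" by simp
  qed (auto simp: a_def)
  ultimately show ?thesis unfolding affine_subspace_codim_def by blast
qed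

text \<open>The index set is left open so that it can be \<open>bool\<close> for the two factors of
  a product and a singleton for a hyperplane.\<close>

lemma affine_subspace_codim_iff_class:
  fixes X :: "(bit ^ 'd) set" and J :: "'j set"
  assumes J: "finite J" "card J = c"
  shows "affine_subspace_codim c X \<longleftrightarrow> X \<in> affine_class J (\<lambda>f. \<forall>j\<in>J. f j = 1)"
proof
  assume "X \<in> affine_class J (\<lambda>f. \<forall>j\<in>J. f j = 1)"
  then obtain u where u: "affine_system J u" "X = {x. \<forall>j\<in>J. u j x = 1}" by (rule affine_classE)
  obtain \<phi> :: "'j \<Rightarrow> 'd" where \<phi>: "inj_on \<phi> J"
    using affine_system_card[OF u(1)] J by (metis card_le_inj finite subset_UNIV)
  obtain g where g: "g \<in> carrier AGL" "\<And>j x. j \<in> J \<Longrightarrow> g x $ \<phi> j = u j x"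
    using affine_system_extend_to_AGL[OF u(1) \<phi>] by metis
  obtain h where h: "h \<in> carrier AGL" "\<And>x. h (g x) = x" "\<And>x. g (h x) = x"
    using AGL_inverse_both[OF g(1)] by metis
  let ?Y = "{x. \<forall>i\<in>\<phi> ` J. x $ i = 1}"
  have X: "x \<in> X \<longleftrightarrow> g x \<in> ?Y" for x by (simp add: u(2) g(2))
  have "X = h ` ?Y"
  proof (intro Set.set_eqI iffI)
    fix x assume "x \<in> X"
    then have "h (g x) \<in> h ` ?Y" using X by blast
    then show "x \<in> h ` ?Y" by (simp add: h)
  next
    fix x assume "x \<in> h ` ?Y"
    then obtain y where "y \<in> ?Y" "x = h y" by blast
    then show "x \<in> X" using X[of "h y"] h(3)[of y] by simp
  qed
  moreover have "card (\<phi> ` J) = c" using J \<phi> by (simp add: card_image)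
  ultimately show "affine_subspace_codim c X"
    using AGL_affine_subspace_codim[OF h(1) coordinate_subspace_codim[of "\<phi> ` J"]] by simp
next
  assume "affine_subspace_codim c X"
  then obtain a U where U: "vec.subspace U" "vec.dim U + c = CARD('d)" "X = (\<lambda>x. a + x) ` U"
    unfolding affine_subspace_codim_def by blast
  have "card J \<le> CARD('d)" using U(2) J(2) by simp
  then obtain \<phi> :: "'j \<Rightarrow> 'd" where \<phi>: "inj_on \<phi> J"
    using J by (metis card_le_inj finite subset_UNIV)
  define K where "K = \<phi> ` J"
  have K: "card (- K) = vec.dim U"
    using U(2) J \<phi> by (simp add: K_def card_image Compl_eq_Diff_UNIV card_Diff_subset)
  obtain B where B: "B \<subseteq> U" "vec.independent B" "U \<subseteq> vec.span B" "card B = vec.dim U"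
    by (rule vec.basis_exists)
  have finB: "finite B" using B(2) by (rule vec.finiteI_independent)
  obtain \<psi> where \<psi>: "bij_betw \<psi> B (- K)"
    using finB B(4) K by (metis finite_same_card_bij finite)
  \<comment> \<open>\<open>transpose A\<close> sends the basis vector at position
    \<open>\<psi> b\<close> to \<open>b\<close>. Its inverse \<open>N\<close> therefore straightens
    \<open>U\<close> to the vectors supported outside \<open>K\<close>.\<close>
  obtain A :: "bit ^ 'd ^ 'd" where A: "invertible A" "\<And>b. b \<in> B \<Longrightarrow> A $ \<psi> b = b"
    using invertible_matrix_with_rows[of id B \<psi>] B(2) \<psi> by (auto simp: bij_betw_def)
  have "invertible (transpose A)"
    using A(1) by (meson invertible_def matrix_left_right_inverse right_invertible_transpose)
  then obtain N where N: "N ** transpose A = mat 1" "transpose A ** N = mat 1"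
    by (auto simp: invertible_def)
  then have "invertible N" by (auto simp: invertible_def)
  let ?U\<^sub>0 = "{x :: bit ^ 'd. \<forall>i. i \<notin> - K \<longrightarrow> x $ i = 0}"
  have N_axis: "N *v b = axis (\<psi> b) 1" if "b \<in> B" for b
  proof -
    have "transpose A *v axis (\<psi> b) 1 = A $ \<psi> b"
      by (simp add: vec_eq_iff matrix_vector_mult_def transpose_def axis_def if_distrib cong: if_cong)
    then show ?thesis
      using A(2)[OF that] N(1) by (metis matrix_vector_mul_assoc matrix_vector_mul_lid)
  qed
  have "(*v) N ` B \<subseteq> ?U\<^sub>0"
    using \<psi> by (auto simp: N_axis axis_def bij_betw_def)
  then have "vec.span ((*v) N ` B) \<subseteq> ?U\<^sub>0"
    using subspace_substandard_cart by (rule vec.span_minimal)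
  moreover have "U = vec.span B"
    using B(1,3) U(1) vec.span_minimal by blast
  then have "vec.span ((*v) N ` B) = (*v) N ` U"
    using vec.linear_span_image[OF matrix_vector_mul_linear_gen] by simp
  ultimately have "(*v) N ` U \<subseteq> ?U\<^sub>0" by simp
  moreover have "vec.subspace ((*v) N ` U)"
    by (rule vec.linear_subspace_image[OF matrix_vector_mul_linear_gen U(1)])
  moreover have injN: "inj ((*v) N)" using \<open>invertible N\<close> by (simp add: inj_matrix_vector_mult)
  then have "vec.dim ((*v) N ` U) = vec.dim U"
    by (rule vec.dim_image_eq[OF matrix_vector_mul_linear_gen inj_on_subset[OF _ subset_UNIV]])
  then have "vec.dim ?U\<^sub>0 \<le> vec.dim ((*v) N ` U)"
    by (simp only: dim_substandard_cart K)
  ultimately have NU: "(*v) N ` U = ?U\<^sub>0"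
    by (intro vec.subspace_dim_equal subspace_substandard_cart)
  \<comment> \<open>The translation part sends the base point \<open>a\<close> to the all-ones
    vector, so that membership in \<open>X\<close> reads as coordinates being 1 on
    \<open>K\<close>.\<close>
  have g: "(\<lambda>x. N *v x + (N *v a + (\<chi> i. 1))) \<in> carrier AGL" (is "?g \<in> _")
    by (rule AGL_memI) fact
  have "X = {x. \<forall>j\<in>J. ?g x $ \<phi> j = 1}"
  proof (intro Set.set_eqI)
    fix x
    have "x \<in> X \<longleftrightarrow> a + x \<in> U" unfolding U(3) by (metis bit_vec_add_cancel(1) image_iff)
    also have "\<dots> \<longleftrightarrow> N *v (a + x) \<in> ?U\<^sub>0"
      using injN NU by (metis (no_types, lifting) image_iff injD)
    also have "\<dots> \<longleftrightarrow> (\<forall>j\<in>J. (N *v x + N *v a) $ \<phi> j = 0)"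
      by (auto simp: K_def matrix_vector_right_distrib add.commute)
    also have "\<dots> \<longleftrightarrow> x \<in> {x. \<forall>j\<in>J. ?g x $ \<phi> j = 1}"
    proof -
      have "p + q = 0 \<longleftrightarrow> p + (q + 1) = 1" for p q :: bit by (cases p; cases q) auto
      then show ?thesis by simp
    qed
    finally show "x \<in> X \<longleftrightarrow> x \<in> {x. \<forall>j\<in>J. ?g x $ \<phi> j = 1}" .
  qed
  then show "X \<in> affine_class J (\<lambda>f. \<forall>j\<in>J. f j = 1)"
    using affine_classI[OF affine_system_AGL[OF g affine_system_coordinates[OF \<phi>]],
        of "\<lambda>f. \<forall>j\<in>J. f j = 1"] by simp
qed

section \<open>Normal forms of quadratic sets\<close>

lemma sym_diff_indicator:
  fixes f g :: "'a \<Rightarrow> bit"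
  shows "sym_diff {x. f x = 1} {x. g x = 1} = {x. f x + g x = 1}"
proof -
  have "a + b = 1 \<longleftrightarrow> (a = 1) \<noteq> (b = 1)" for a b :: bit by (cases a; cases b) auto
  then show ?thesis by auto
qed

lemma sum_pairs: "finite I \<Longrightarrow> (\<Sum>j\<in>I \<times> UNIV. g j) = (\<Sum>i\<in>I. g (i, False) + g (i, True))"
  for g :: "'i \<times> bool \<Rightarrow> 'a::comm_monoid_add"
  by (simp only: sum.cartesian_product') (simp add: UNIV_bool)

text \<open>The index \<open>(i, b)\<close> is factor b of product i; with all factors in one index
  set, their joint independence is a statement about a single system.\<close>

definition quad :: "'i set \<Rightarrow> ('i \<times> bool \<Rightarrow> bit) \<Rightarrow> bit"
  where "quad I f = (\<Sum>i\<in>I. f (i, False) * f (i, True))"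

lemma quad_cong: "(\<And>j. j \<in> I \<times> UNIV \<Longrightarrow> f j = g j) \<Longrightarrow> quad I f = quad I g"
  unfolding quad_def by (rule sum.cong) auto

text \<open>
  If the factors are dependent, one factor \<open>U\<close> of a product \<open>U * V\<close> is a combination
  of the other factors, and since \<open>V * V = V\<close> that product can be absorbed into the others:
  \<open>p * q + \<alpha> * p * V + \<beta> * q * V = (p + \<beta> * V) * (q + \<alpha> * V) + \<alpha> * \<beta> * V\<close>.
\<close>

lemma quad_reduction_step:
  fixes u :: "'i \<times> bool \<Rightarrow> bit ^ 'd \<Rightarrow> bit"
  assumes I: "finite I" and u: "\<forall>j\<in>I \<times> UNIV. affine_fun (u j)" and w: "affine_fun w"
    and dep: "\<not> affine_system (I \<times> UNIV) u"
  shows "\<exists>k\<in>I. \<exists>u' w'. (\<forall>j\<in>(I - {k}) \<times> UNIV. affine_fun (u' j)) \<and> affine_fun w' \<and>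
    (\<forall>x. quad I (\<lambda>j. u j x) + w x = quad (I - {k}) (\<lambda>j. u' j x) + w' x)"
proof -
  have "\<not> affinely_independent (I \<times> UNIV) u"
    using dep u I by (auto simp: affine_system_def)
  then obtain c e where rel: "\<forall>x. (\<Sum>j\<in>I \<times> UNIV. c j * u j x) = e"
    and "\<not> (\<forall>j\<in>I \<times> UNIV. c j = 0)"
    unfolding affinely_independent_def by blast
  then obtain j where j: "j \<in> I \<times> UNIV" "c j = 1" by auto
  obtain k b where k: "k \<in> I" "c (k, b) = 1" using j by (cases j) auto
  \<comment> \<open>\<open>U = u (k, b)\<close> is the factor to be eliminated; \<open>V\<close>
    below is its partner in the same product.\<close>
  define J where "J = I - {k}"
  have J: "finite J" "I = insert k J" "k \<notin> J" using I k by (auto simp: J_def)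
  define V where "V = u (k, \<not> b)"
  \<comment> \<open>As in the identity above, each factor receives \<open>V\<close> with the
    coefficient of its partner. The remaining multiples of \<open>V\<close> are collected in
    \<open>\<gamma>\<close>: the products of partner coefficients, the term coming from
    \<open>V * V = V\<close>, and the constant \<open>e\<close>.\<close>
  define u' where "u' j x = u j x + c (fst j, \<not> snd j) * V x" for j x
  define \<gamma> where "\<gamma> = (\<Sum>i\<in>J. c (i, False) * c (i, True)) + c (k, \<not> b) + e"
  have V: "affine_fun V" using u k by (simp add: V_def)
  have "quad I (\<lambda>j. u j x) + w x = quad J (\<lambda>j. u' j x) + (\<gamma> * V x + w x)" for x
  proof -
    let ?s = "\<lambda>i. c (i, False) * u (i, False) x + c (i, True) * u (i, True) x"
    have "e = (\<Sum>i\<in>J. ?s i) + (u (k, b) x + c (k, \<not> b) * V x)"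
      using rel[rule_format, of x] k(2) J by (cases b) (simp_all add: sum_pairs V_def ac_simps)
    moreover have "e' = s + (p + q) \<Longrightarrow> p = s + q + e'" for e' s p q :: bit
      by (cases s; cases p; cases q) auto
    ultimately have U: "u (k, b) x = (\<Sum>i\<in>J. ?s i) + c (k, \<not> b) * V x + e"
      by blast
    have "quad J (\<lambda>j. u' j x) = (\<Sum>i\<in>J. u (i, False) x * u (i, True) x + ?s i * V x
        + c (i, False) * c (i, True) * V x)"
      unfolding quad_def
    proof (rule sum.cong)
      fix i show "u' (i, False) x * u' (i, True) x = u (i, False) x * u (i, True) x + ?s i * V x
        + c (i, False) * c (i, True) * V x"
        by (cases "V x") (simp_all add: u'_def distrib_left distrib_right ac_simps)
    qed simp
    also have "\<dots> = quad J (\<lambda>j. u j x) + (\<Sum>i\<in>J. ?s i) * V x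
        + (\<Sum>i\<in>J. c (i, False) * c (i, True)) * V x"
      by (simp add: quad_def sum.distrib flip: sum_distrib_right)
    finally have 1: "quad J (\<lambda>j. u' j x) = \<dots>" .
    have "quad I (\<lambda>j. u j x) = quad J (\<lambda>j. u j x) + u (k, b) x * V x"
      using J by (cases b) (simp_all add: quad_def V_def ac_simps)
    then show ?thesis
      unfolding 1 U \<gamma>_def by (cases "V x") (simp_all add: ac_simps)
  qed
  moreover have "affine_fun (u' j)" if "j \<in> J \<times> UNIV" for j
    unfolding u'_def using that bspec[OF u, of j] V J(2) by (intro affine_fun_add affine_fun_cmult) auto
  moreover have "affine_fun (\<lambda>x. \<gamma> * V x + w x)" using V w by auto
  ultimately show ?thesis
    by (intro bexI[OF _ k(1)] exI[of _ u'] exI[of _ "\<lambda>x. \<gamma> * V x + w x"]) (simp add: J_def)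
qed

text \<open>Each dependence removes one product and changes the remainder only by an affine
  function, so the reduction stops at an independent system.\<close>

lemma quad_reduction:
  fixes u :: "'i \<times> bool \<Rightarrow> bit ^ 'd \<Rightarrow> bit"
  assumes "finite I" "\<forall>j\<in>I \<times> UNIV. affine_fun (u j)" "affine_fun w"
  shows "\<exists>(J :: 'i set) u' w'. finite J \<and> affine_system (J \<times> UNIV) u' \<and> affine_fun w' \<and>
    (\<forall>x. quad I (\<lambda>j. u j x) + w x = quad J (\<lambda>j. u' j x) + w' x)"
  using assms
proof (induction "card I" arbitrary: I u w rule: less_induct)
  case less
  show ?case
  proof (cases "affine_system (I \<times> UNIV) u")
    case True
    with less.prems show ?thesis
      by (intro exI[of _ I] exI[of _ u] exI[of _ w]) simp
  next
    case False
    from quad_reduction_step[OF less.prems False] show ?thesis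
    proof (elim bexE exE conjE)
      fix k u' w'
      assume k: "k \<in> I" and u': "\<forall>j\<in>(I - {k}) \<times> UNIV. affine_fun (u' j)" "affine_fun w'"
        and eq: "\<forall>x. quad I (\<lambda>j. u j x) + w x = quad (I - {k}) (\<lambda>j. u' j x) + w' x"
      have "card (I - {k}) < card I" using less.prems(1) k by (rule card_Diff1_less)
      moreover have "finite (I - {k})" using less.prems(1) by simp
      ultimately show ?thesis
        unfolding eq[rule_format] using u' by (intro less.hyps[of "I - {k}" u' w']) simp_all
    qed
  qed
qed

abbreviation pairs :: "nat \<Rightarrow> (nat \<times> bool) set"
  where "pairs k \<equiv> {1..k} \<times> UNIV"

definition short_class :: "nat \<Rightarrow> (bit ^ 'd) set set"
  where "short_class k = affine_class (pairs k) (\<lambda>f. quad {1..k} f = 1)"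

definition long_class :: "nat \<Rightarrow> (bit ^ 'd) set set"
  where "long_class k = affine_class (pairs k) (\<lambda>f. quad {1..k} f \<noteq> 1)"

text \<open>Products are numbered from 1, which leaves \<open>(0, False)\<close> free for the one
  further coordinate.\<close>

definition mid_class :: "nat \<Rightarrow> (bit ^ 'd) set set"
  where "mid_class k =
    affine_class (insert (0, False) (pairs k)) (\<lambda>f. quad {1..k} f + f (0, False) = 1)"

text \<open>That the same k appears in all three alternatives is essential later, when two
  representations of one midset are compared.\<close>

lemma quad_absorb_affine:
  assumes u: "affine_system (pairs k) u" and w: "affine_fun w"
  shows "{x. quad {1..k} (\<lambda>j. u j x) + w x = 1} \<in> short_class k \<union> long_class k \<union> mid_class k"
proof (cases "affine_system (insert (0, False) (pairs k)) (u((0, False) := w))")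
  case True
  have "quad {1..k} (\<lambda>j. (u((0, False) := w)) j x) = quad {1..k} (\<lambda>j. u j x)" for x
    by (rule quad_cong) auto
  then show ?thesis
    using affine_classI[OF True, of "\<lambda>f. quad {1..k} f + f (0, False) = 1"]
    unfolding mid_class_def by simp
next
  case False
  have "(0, False) \<notin> pairs k" by simp
  then obtain c e where c: "\<And>x. w x = (\<Sum>j\<in>pairs k. c j * u j x) + e"
    using affine_system_span[OF u w _ False] by metis
  \<comment> \<open>If \<open>w\<close> has coefficients \<alpha> on p and \<beta> on q, then (p +
    \<beta>) * (q + \<alpha>) = p * q + \<alpha> * p + \<beta> * q + \<alpha> * \<beta>. So each
    factor is shifted by the coefficient of its partner, and \<open>e'\<close> gathers the
    constants.\<close>
  define u' where "u' j x = u j x + c (fst j, \<not> snd j)" for j x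
  define e' where "e' = (\<Sum>i = 1..k. c (i, False) * c (i, True)) + e"
  have u': "affine_system (pairs k) u'"
    unfolding u'_def by (rule affine_system_add_const[OF u])
  have eq: "quad {1..k} (\<lambda>j. u j x) + w x = quad {1..k} (\<lambda>j. u' j x) + e'" for x
  proof -
    have "quad {1..k} (\<lambda>j. u' j x) = (\<Sum>i = 1..k. u (i, False) x * u (i, True) x
        + (c (i, False) * u (i, False) x + c (i, True) * u (i, True) x) + c (i, False) * c (i, True))"
      unfolding quad_def u'_def by (rule sum.cong) (auto simp: distrib_left distrib_right ac_simps)
    also have "\<dots> = quad {1..k} (\<lambda>j. u j x) + (w x + e) + (e' + e)"
      by (simp add: c e'_def quad_def sum.distrib sum_pairs add.assoc)
    also have "\<dots> = quad {1..k} (\<lambda>j. u j x) + w x + e'"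
      by (simp add: ac_simps)
    finally show ?thesis by (simp add: add.assoc)
  qed
  show ?thesis
  proof (cases e')
    case zero
    then show ?thesis
      unfolding eq short_class_def
      using affine_classI[OF u', of "\<lambda>f. quad {1..k} f = 1"] by simp
  next
    case one
    have "q + 1 = 1 \<longleftrightarrow> q \<noteq> 1" for q :: bit by (cases q) auto
    then show ?thesis
      unfolding eq long_class_def one
      using affine_classI[OF u', of "\<lambda>f. quad {1..k} f \<noteq> 1"] by simp
  qed
qed

section \<open>Codewords as 1-sets of quadratic polynomials\<close>

definition quadratic_set :: "(bit ^ 'd) set \<Rightarrow> bool"
  where "quadratic_set X \<longleftrightarrow> (\<exists>(I :: nat set) u w. finite I \<and> (\<forall>j\<in>I \<times> UNIV. affine_fun (u j)) \<and>
    affine_fun w \<and> X = {x. quad I (\<lambda>j. u j x) + w x = 1})"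

lemma codim_2_of_product:
  assumes u: "affine_system (UNIV :: bool set) u"
  shows "affine_subspace_codim 2 {x. u False x * u True x = 1}"
proof -
  have "{x. u False x * u True x = 1} = {x. \<forall>j\<in>UNIV. u j x = 1}"
    by (auto simp: bit_mult_eq_1_iff all_bool_eq)
  then show ?thesis
    using affine_classI[OF u, of "\<lambda>f. \<forall>j\<in>UNIV. f j = 1"]
    by (subst affine_subspace_codim_iff_class[where J = "UNIV :: bool set"]) auto
qed

lemma codim_2_product:
  assumes "affine_subspace_codim 2 A"
  obtains u where "affine_system (UNIV :: bool set) u" "A = {x. u False x * u True x = 1}"
proof -
  have "A \<in> affine_class (UNIV :: bool set) (\<lambda>f. \<forall>j\<in>UNIV. f j = 1)"
    using assms by (subst (asm) affine_subspace_codim_iff_class[where J = "UNIV :: bool set"]) auto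
  then obtain u where u: "affine_system (UNIV :: bool set) u" "A = {x. \<forall>j. u j x = 1}"
    by (auto elim: affine_classE)
  then have "A = {x. u False x * u True x = 1}" by (auto simp: bit_mult_eq_1_iff all_bool_eq)
  with u(1) show thesis by (rule that)
qed

text \<open>Adding a codeword to an arbitrary quadratic set makes the induction easy: a generator
  contributes a single product, and a sum is handled by associativity, without merging two index
  sets.\<close>

lemma RM2_quadratic_aux:
  assumes "X \<in> RM2" "quadratic_set Y"
  shows "quadratic_set (sym_diff X Y)"
  using assms
proof (induction arbitrary: Y)
  case (generator A)
  obtain v where v: "affine_system (UNIV :: bool set) v" "A = {x. v False x * v True x = 1}"
    using codim_2_product[OF generator(1)] by metis
  obtain I :: "nat set" and u w where Y: "finite I" "\<forall>j\<in>I \<times> UNIV. affine_fun (u j)" "affine_fun w"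
      "Y = {x. quad I (\<lambda>j. u j x) + w x = 1}"
    using generator(2) unfolding quadratic_set_def by blast
  \<comment> \<open>Index sets of natural numbers always leave room for another product.\<close>
  obtain n where n: "n \<notin> I" using Y(1) ex_new_if_finite infinite_UNIV_nat by blast
  define u' where "u' j = (if fst j = n then v (snd j) else u j)" for j
  have q: "quad (insert n I) (\<lambda>j. u' j x) = v False x * v True x + quad I (\<lambda>j. u j x)" for x
  proof -
    have "quad I (\<lambda>j. u' j x) = quad I (\<lambda>j. u j x)"
      by (rule quad_cong) (use n in \<open>auto simp: u'_def\<close>)
    then show ?thesis using Y(1) n by (simp add: quad_def u'_def)
  qed
  have "sym_diff A Y = {x. quad (insert n I) (\<lambda>j. u' j x) + w x = 1}"
    unfolding v(2) Y(4) sym_diff_indicator q by (simp add: add.assoc)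
  moreover have "\<forall>j\<in>insert n I \<times> UNIV. affine_fun (u' j)"
    using Y(2) affine_systemD(3)[OF v(1)] by (auto simp: u'_def)
  ultimately show ?case
    unfolding quadratic_set_def using Y(1,3) finite_insert by blast
next
  case (add X Z)
  have "sym_diff (sym_diff X Z) Y = sym_diff X (sym_diff Z Y)" by auto
  then show ?case using add by simp
qed simp

lemma RM2_quadratic:
  assumes "X \<in> RM2"
  shows "quadratic_set X"
proof -
  have "quadratic_set ({} :: (bit ^ 'd) set)"
    unfolding quadratic_set_def
    by (rule exI[of _ "{}"], rule exI[of _ "\<lambda>_ _. 0"], rule exI[of _ "\<lambda>_. 0"]) (simp add: quad_def)
  from RM2_quadratic_aux[OF assms this] show ?thesis by simp
qed

lemma RM2_cases:
  assumes "X \<in> RM2"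
  obtains k where "X \<in> short_class k \<union> long_class k \<union> mid_class k"
proof -
  obtain I :: "nat set" and u w where "finite I" "\<forall>j\<in>I \<times> UNIV. affine_fun (u j)" "affine_fun w"
      and X: "X = {x. quad I (\<lambda>j. u j x) + w x = 1}"
    using RM2_quadratic[OF assms] unfolding quadratic_set_def by blast
  then obtain J :: "nat set" and u' w' where J: "finite J" "affine_system (J \<times> UNIV) u'" "affine_fun w'"
      "\<And>x. quad I (\<lambda>j. u j x) + w x = quad J (\<lambda>j. u' j x) + w' x"
    using quad_reduction[of I u w] by metis
  obtain h where h: "bij_betw h {1..card J} J"
    using ex_bij_betw_nat_finite_1[OF J(1)] by blast
  define v where "v j = u' (h (fst j), snd j)" for j
  have "affine_system (pairs (card J)) (\<lambda>j. u' (map_prod h id j))"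
    using h by (intro affine_system_reindex[OF J(2)] inj_on_subset[OF map_prod_inj_on[of h "{1..card J}" id UNIV]])
      (auto simp: bij_betw_def)
  then have v: "affine_system (pairs (card J)) v"
    by (simp add: v_def[abs_def] map_prod_def case_prod_unfold)
  have "quad J (\<lambda>j. u' j x) = quad {1..card J} (\<lambda>j. v j x)" for x
    unfolding quad_def v_def using sum.reindex_bij_betw[OF h, of "\<lambda>i. u' (i, False) x * u' (i, True) x"]
    by simp
  then have "X = {x. quad {1..card J} (\<lambda>j. v j x) + w' x = 1}" by (simp add: X J(4))
  then show thesis using quad_absorb_affine[OF v J(3)] that by simp
qed

section \<open>Membership in the code and cardinalities\<close>

lemma boolean_sum_indicator:
  fixes f :: "nat \<Rightarrow> 'a \<Rightarrow> bit"
  assumes "\<And>i. i \<in> {1..k} \<Longrightarrow> S i = {x. f i x = 1}"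
  shows "boolean_sum S k = {x. (\<Sum>i = 1..k. f i x) = 1}"
  using assms
proof (induction k)
  case (Suc k)
  then have "boolean_sum S (Suc k) = sym_diff {x. (\<Sum>i = 1..k. f i x) = 1} {x. f (Suc k) x = 1}"
    by simp
  also have "\<dots> = {x. (\<Sum>i = 1..Suc k. f i x) = 1}"
    by (simp only: sym_diff_indicator) simp
  finally show ?case .
qed simp

lemma RM2_product:
  "affine_system (UNIV :: bool set) u \<Longrightarrow> {x. u False x * u True x = 1} \<in> RM2"
  by (intro RM2.generator codim_2_of_product)

text \<open>With a second coordinate g, available because d is at least 2,
  \<open>f = f * g + f * (g + 1)\<close>; both products have subspaces of codimension 2 as their
  1-sets.\<close>

lemma RM2_nonconstant_affine:
  fixes f :: "bit ^ 'd \<Rightarrow> bit"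
  assumes d: "CARD('d) \<ge> 2" and f: "affine_system {True} (\<lambda>_. f)"
  shows "{x. f x = 1} \<in> RM2"
proof -
  obtain i j :: 'd where ij: "i \<noteq> j"
    using d by (metis card_2_iff' ex_card UNIV_I)
  obtain g where g: "g \<in> carrier AGL" "\<And>x. g x $ i = f x"
    using affine_system_extend_to_AGL[OF f, of "\<lambda>_. i"] by (metis inj_on_insert inj_on_empty empty_Diff image_empty empty_iff singletonI)
  have inj: "inj_on (\<lambda>b. if b then i else j) UNIV" using ij by (auto simp: inj_on_def)
  define u where "u b x = g x $ (if b then i else j)" for b x
  have u: "affine_system UNIV u"
    unfolding u_def by (rule affine_system_AGL[OF g(1) affine_system_coordinates[OF inj]])
  define v where "v b x = u b x + (if b then 0 else 1)" for b x
  have v: "affine_system UNIV v"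
    unfolding v_def by (rule affine_system_add_const[OF u])
  have "f x = u False x * u True x + v False x * v True x" for x
    by (simp add: u_def v_def g(2) distrib_right)
  then have "{x. f x = 1} = sym_diff {x. u False x * u True x = 1} {x. v False x * v True x = 1}"
    by (simp only: sym_diff_indicator)
  then show ?thesis using RM2.add[OF RM2_product[OF u] RM2_product[OF v]] by simp
qed

lemma RM2_UNIV:
  assumes d: "CARD('d) \<ge> 2"
  shows "(UNIV :: (bit ^ 'd) set) \<in> RM2"
proof -
  obtain i :: 'd where True by simp
  have f: "affine_system {True} (\<lambda>_ (x :: bit ^ 'd). x $ i)"
    by (rule affine_system_coordinates) simp
  have g: "affine_system {True} (\<lambda>_ (x :: bit ^ 'd). x $ i + 1)"
    by (rule affine_system_add_const[OF f])
  have "sym_diff {x :: bit ^ 'd. x $ i = 1} {x. x $ i + 1 = 1} = UNIV"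
    by (simp only: sym_diff_indicator) simp
  then show ?thesis
    using RM2.add[OF RM2_nonconstant_affine[OF d f] RM2_nonconstant_affine[OF d g]] by simp
qed

lemma RM2_Compl: "CARD('d) \<ge> 2 \<Longrightarrow> X \<in> RM2 \<Longrightarrow> - X \<in> (RM2 :: (bit ^ 'd) set set)"
  using RM2.add[OF RM2_UNIV] by (fastforce simp: Compl_eq_Diff_UNIV)

lemma RM2_quad:
  assumes "affine_system (I \<times> UNIV) u" "finite I"
  shows "{x. quad I (\<lambda>j. u j x) = 1} \<in> RM2"
  using assms(2,1)
proof (induction I)
  case empty
  then show ?case by (simp add: quad_def RM2.zero)
next
  case (insert i I)
  have "affine_system (UNIV :: bool set) (\<lambda>b. u (i, b))"
    by (rule affine_system_reindex[OF insert.prems]) (auto simp: inj_on_def)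
  then have "{x. u (i, False) x * u (i, True) x = 1} \<in> RM2" by (rule RM2_product)
  moreover have "{x. quad I (\<lambda>j. u j x) = 1} \<in> RM2"
    by (rule insert.IH[OF affine_system_subset[OF insert.prems]]) auto
  moreover have "{x. quad (insert i I) (\<lambda>j. u j x) = 1} =
      sym_diff {x. u (i, False) x * u (i, True) x = 1} {x. quad I (\<lambda>j. u j x) = 1}"
    unfolding sym_diff_indicator using insert.hyps by (simp add: quad_def)
  ultimately show ?case using RM2.add by simp
qed

lemma short_class_RM2: "short_class k \<subseteq> RM2"
  unfolding short_class_def by (auto elim!: affine_classE intro: RM2_quad)

lemma long_class_eq: "long_class k = uminus ` short_class k"
  unfolding short_class_def long_class_def uminus_affine_class ..

lemma long_class_RM2: "CARD('d) \<ge> 2 \<Longrightarrow> (long_class k :: (bit ^ 'd) set set) \<subseteq> RM2"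
  unfolding long_class_eq using short_class_RM2 RM2_Compl by blast

lemma mid_class_RM2:
  assumes d: "CARD('d) \<ge> 2"
  shows "(mid_class k :: (bit ^ 'd) set set) \<subseteq> RM2"
proof
  fix X :: "(bit ^ 'd) set"
  assume "X \<in> mid_class k"
  then obtain u where u: "affine_system (insert (0, False) (pairs k)) u"
    and X: "X = {x. quad {1..k} (\<lambda>j. u j x) + u (0, False) x = 1}"
    unfolding mid_class_def by (rule affine_classE)
  have "affine_system {True} (\<lambda>_. u (0, False))"
    by (rule affine_system_reindex[OF u, where h = "\<lambda>_. (0, False)"]) auto
  moreover have "affine_system (pairs k) u"
    by (rule affine_system_subset[OF u]) auto
  ultimately show "X \<in> RM2"
    unfolding X sym_diff_indicator[symmetric]
    by (intro RM2.add RM2_nonconstant_affine[OF d] RM2_quad) auto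
qed

section \<open>Cardinalities by character sums\<close>

lemma sum_translate:
  fixes f :: "bit ^ 'd \<Rightarrow> 'a::comm_monoid_add"
  shows "(\<Sum>x\<in>UNIV. f (x + t)) = (\<Sum>x\<in>UNIV. f x)"
  by (rule sum.reindex_bij_witness[where i = "\<lambda>x. x + t" and j = "\<lambda>x. x + t"])
     (simp_all add: add.assoc)

text \<open>The nontrivial additive character of F_2, with integer values.\<close>

definition bit_sign :: "bit \<Rightarrow> int"
  where "bit_sign b = (if b = 0 then 1 else - 1)"

lemma sum_sign_eq_card:
  fixes f :: "bit ^ 'd \<Rightarrow> bit"
  shows "(\<Sum>x\<in>UNIV. bit_sign (f x)) = 2 ^ CARD('d) - 2 * int (card {x. f x = 1})"
proof -
  have "(\<Sum>x\<in>UNIV. bit_sign (f x)) = (\<Sum>x\<in>UNIV. 1 - 2 * (if f x = 1 then 1 else 0))"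
    by (rule sum.cong) (auto simp: bit_sign_def)
  also have "\<dots> = int (card (UNIV :: (bit ^ 'd) set)) - 2 * int (card {x. f x = 1})"
    by (simp add: sum_subtractf sum.If_cases flip: sum_distrib_left)
  finally show ?thesis by simp
qed

text \<open>
  Averaging over the four translates that flip the two factors of one product removes
  that product and halves the character sum.
\<close>

lemma sum_sign_quad:
  fixes u :: "'i \<times> bool \<Rightarrow> bit ^ 'd \<Rightarrow> bit"
  assumes "finite I" "affine_system (I \<times> UNIV) u"
  shows "2 ^ card I * (\<Sum>x\<in>UNIV. bit_sign (quad I (\<lambda>j. u j x))) = 2 ^ CARD('d)"
  using assms
proof (induction I)
  case empty
  then show ?case by (simp add: quad_def bit_sign_def)
next
  case (insert i I)
  let ?q = "\<lambda>x. quad I (\<lambda>j. u j x)" and ?a = "u (i, False)" and ?b = "u (i, True)"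
  let ?F = "\<lambda>x. bit_sign (?q x + ?a x * ?b x)"
  obtain s where s: "\<And>j x. j \<in> insert i I \<times> UNIV \<Longrightarrow>
      u j (x + s) = u j x + (if j = (i, False) then 1 else 0)"
    using affine_system_shift[OF insert.prems, of "\<lambda>j. if j = (i, False) then 1 else 0"] by metis
  obtain t where t: "\<And>j x. j \<in> insert i I \<times> UNIV \<Longrightarrow>
      u j (x + t) = u j x + (if j = (i, True) then 1 else 0)"
    using affine_system_shift[OF insert.prems, of "\<lambda>j. if j = (i, True) then 1 else 0"] by metis
  have qs: "?q (x + s) = ?q x" for x
    by (rule quad_cong) (use insert.hyps s in auto)
  have qt: "?q (x + t) = ?q x" for x
    by (rule quad_cong) (use insert.hyps t in auto)
  have ab: "?a (x + s) = ?a x + 1" "?b (x + s) = ?b x" "?a (x + t) = ?a x" "?b (x + t) = ?b x + 1" for x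
    using s t by auto
  \<comment> \<open>The four translates run through all values of the two factors. Their product is
    1 exactly once, leaving three equal signs and one opposite sign.\<close>
  have four: "?F x + ?F (x + s) + ?F (x + t) + ?F (x + s + t) = 2 * bit_sign (?q x)" for x
    unfolding qs qt ab by (cases "?q x"; cases "?a x"; cases "?b x") (simp_all add: bit_sign_def)
  have "4 * (\<Sum>x\<in>UNIV. ?F x) = (\<Sum>x\<in>UNIV. ?F x + ?F (x + s) + ?F (x + t) + ?F (x + s + t))"
    using sum_translate[of ?F s] sum_translate[of ?F t] sum_translate[of "\<lambda>x. ?F (x + t)" s]
    by (simp add: sum.distrib)
  also have "\<dots> = 2 * (\<Sum>x\<in>UNIV. bit_sign (?q x))"
    unfolding four by (simp add: sum_distrib_left)
  finally have half: "2 * (\<Sum>x\<in>UNIV. ?F x) = (\<Sum>x\<in>UNIV. bit_sign (?q x))" by simp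
  have "affine_system (I \<times> UNIV) u" by (rule affine_system_subset[OF insert.prems]) auto
  then have IH: "2 ^ card I * (\<Sum>x\<in>UNIV. bit_sign (?q x)) = 2 ^ CARD('d)" by (rule insert.IH)
  have "quad (insert i I) (\<lambda>j. u j x) = ?q x + ?a x * ?b x" for x
    using insert.hyps by (simp add: quad_def add.commute)
  then have "2 ^ card (insert i I) * (\<Sum>x\<in>UNIV. bit_sign (quad (insert i I) (\<lambda>j. u j x)))
      = 2 ^ card I * (2 * (\<Sum>x\<in>UNIV. ?F x))"
    using insert.hyps by simp
  then show ?case using IH unfolding half by simp
qed

text \<open>The additive form avoids truncated subtraction on natural numbers.\<close>

lemma card_short_class:
  fixes X :: "(bit ^ 'd) set"
  assumes X: "X \<in> short_class k"
  shows "card X + 2 ^ (CARD('d) - k - 1) = 2 ^ (CARD('d) - 1)" "2 * k \<le> CARD('d)"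
proof -
  obtain u where u: "affine_system (pairs k) u" and X: "X = {x. quad {1..k} (\<lambda>j. u j x) = 1}"
    using X unfolding short_class_def by (rule affine_classE)
  show k: "2 * k \<le> CARD('d)"
    using affine_system_card[OF u] by (simp add: card_cartesian_product)
  let ?d = "CARD('d)"
  have "?d > 0" by simp
  \<comment> \<open>From \<open>2 * k \<le> d\<close> and \<open>d > 0\<close> follows
    \<open>k + 1 \<le> d\<close>, so the exponent is not truncated.\<close>
  with k have d: "?d = Suc (k + (?d - k - 1))" by linarith
  have "2 ^ k * (2 ^ ?d - 2 * int (card X)) = 2 ^ ?d"
    using sum_sign_quad[OF _ u] by (simp add: sum_sign_eq_card X)
  also have "\<dots> = 2 ^ k * (2 * 2 ^ (?d - k - 1))"
    by (subst d) (simp add: power_add)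
  finally have "2 ^ ?d - 2 * int (card X) = 2 * 2 ^ (?d - k - 1)" by simp
  moreover have "(2 :: int) ^ ?d = 2 * 2 ^ (?d - 1)"
    using power_Suc[of "2 :: int" "?d - 1"] by simp
  ultimately have "int (card X + 2 ^ (?d - k - 1)) = int (2 ^ (?d - 1))" by simp
  then show "card X + 2 ^ (?d - k - 1) = 2 ^ (?d - 1)" by (simp only: of_nat_eq_iff)
qed

lemma card_long_class:
  fixes X :: "(bit ^ 'd) set"
  assumes X: "X \<in> long_class k"
  shows "card X = 2 ^ (CARD('d) - 1) + 2 ^ (CARD('d) - k - 1)" "2 * k \<le> CARD('d)"
proof -
  obtain Y :: "(bit ^ 'd) set" where Y: "Y \<in> short_class k" "X = - Y" using X by (auto simp: long_class_eq)
  have "card X = 2 ^ CARD('d) - card Y"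
    unfolding Y(2) Compl_eq_Diff_UNIV by (simp add: card_Diff_subset)
  moreover have "(2 :: nat) ^ CARD('d) = 2 * 2 ^ (CARD('d) - 1)"
    using power_Suc[of "2 :: nat" "CARD('d) - 1"] by simp
  ultimately show "card X = 2 ^ (CARD('d) - 1) + 2 ^ (CARD('d) - k - 1)"
    using card_short_class(1)[OF Y(1)] by linarith
  show "2 * k \<le> CARD('d)" using card_short_class(2)[OF Y(1)] .
qed

text \<open>A translation that flips only the extra coordinate negates every sign, so the character
  sum vanishes.\<close>

lemma card_mid_class:
  fixes X :: "(bit ^ 'd) set"
  assumes X: "X \<in> mid_class k"
  shows "card X = 2 ^ (CARD('d) - 1)" "2 * k + 1 \<le> CARD('d)"
proof -
  let ?J = "insert (0, False) (pairs k)"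
  obtain u where u: "affine_system ?J u"
    and X: "X = {x. quad {1..k} (\<lambda>j. u j x) + u (0, False) x = 1}"
    using X unfolding mid_class_def by (rule affine_classE)
  show "2 * k + 1 \<le> CARD('d)"
    using affine_system_card[OF u] by (simp add: card_cartesian_product)
  obtain t where t: "\<And>j x. j \<in> ?J \<Longrightarrow> u j (x + t) = u j x + (if j = (0, False) then 1 else 0)"
    using affine_system_shift[OF u, of "\<lambda>j. if j = (0, False) then 1 else 0"] by metis
  let ?F = "\<lambda>x. bit_sign (quad {1..k} (\<lambda>j. u j x) + u (0, False) x)"
  have q: "quad {1..k} (\<lambda>j. u j (x + t)) = quad {1..k} (\<lambda>j. u j x)" for x
    by (rule quad_cong) (use t in auto)
  have "bit_sign (p + (q + 1)) = - bit_sign (p + q)" for p q :: bit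
    by (cases p; cases q) (simp_all add: bit_sign_def)
  then have "?F (x + t) = - ?F x" for x
    unfolding q using t[of "(0, False)" x] by simp
  then have "(\<Sum>x\<in>UNIV. ?F x) = - (\<Sum>x\<in>UNIV. ?F x)"
    using sum_translate[of ?F t] by (simp add: sum_negf)
  then have "int (2 * card X) = int (2 ^ CARD('d))"
    unfolding sum_sign_eq_card X by simp
  then have "2 * card X = 2 ^ CARD('d)" by (simp only: of_nat_eq_iff)
  moreover have "(2 :: nat) ^ CARD('d) = 2 * 2 ^ (CARD('d) - 1)"
    using power_Suc[of "2 :: nat" "CARD('d) - 1"] by simp
  ultimately show "card X = 2 ^ (CARD('d) - 1)" by simp
qed

section \<open>Coindependent families\<close>

text \<open>Both factors are 1 at \<open>p\<close>, so moving \<open>p\<close> to the origin turns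
  the condition of being 1 into vanishing of the linear part. Hence the result is the same for every
  choice of \<open>p\<close>.\<close>

lemma product_direction_space:
  assumes u: "affine_system (UNIV :: bool set) u"
    and p: "p \<in> {x. u False x * u True x = 1}"
  shows "(\<lambda>x. x - p) ` {x. u False x * u True x = 1} = {x. \<forall>b. u b x = u b 0}"
proof -
  have p1: "u b p = 1" for b using p by (cases b) (auto simp: bit_mult_eq_1_iff)
  have *: "u b (x + p) = u b x + 1 + u b 0" for b x
    using affine_funD[OF affine_systemD(3)[OF u UNIV_I], of b x p] by (simp add: p1)
  have **: "a + 1 + c = 1 \<longleftrightarrow> a = c" for a c :: bit by (cases a; cases c) auto
  show ?thesis
  proof (intro equalityI subsetI)
    fix y assume "y \<in> (\<lambda>x. x - p) ` {x. u False x * u True x = 1}"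
    then obtain x where x: "u False x * u True x = 1" "y = x + p" by auto
    have "y + p = x" by (simp add: x add.assoc)
    then have "u b y + 1 + u b 0 = 1" for b
      using x(1) *[of b y] by (cases b) (simp_all add: bit_mult_eq_1_iff)
    then show "y \<in> {x. \<forall>b. u b x = u b 0}" by (simp add: **)
  next
    fix y assume "y \<in> {x. \<forall>b. u b x = u b 0}"
    then have "u False (y + p) * u True (y + p) = 1" by (simp add: * ** bit_mult_eq_1_iff)
    moreover have "y = (y + p) - p" by (simp add: add.assoc)
    ultimately show "y \<in> (\<lambda>x. x - p) ` {x. u False x * u True x = 1}" by blast
  qed
qed

lemma annihilator_direction_space:
  assumes u: "affine_system (UNIV :: bool set) u"
    and f: "f \<in> annihilator {x. \<forall>b. u b x = u b 0}"
  shows "\<exists>c e. \<forall>x. f x = (\<Sum>b\<in>UNIV. c b * u b x) + e"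
proof -
  \<comment> \<open>Wrapping the indices in \<open>Some\<close> frees \<open>None\<close> as the
    index of \<open>f\<close>; all of \<open>bool\<close> is already taken.\<close>
  have "affine_system (range Some) (\<lambda>j. u (the j))"
    by (rule affine_system_reindex[OF u]) (auto simp: inj_on_def)
  \<comment> \<open>Removing the constants makes the common zero set equal to the direction
    space.\<close>
  then have "affine_system (range Some) (\<lambda>j x. u (the j) x + u (the j) 0)"
    by (rule affine_system_add_const)
  moreover have "affine_fun f" using f by (simp add: annihilator_def linear_iff_affine_fun)
  moreover have "f x = 0" if "\<And>j. j \<in> range Some \<Longrightarrow> u (the j) x + u (the j) 0 = 0" for x
  proof -
    have "u b x = u b 0" for b using that[of "Some b"] by (simp add: bit_add_eq_0_iff)
    then show ?thesis using f by (simp add: annihilator_def)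
  qed
  ultimately obtain c e where *: "\<And>x. f x = (\<Sum>j\<in>range Some. c j * (u (the j) x + u (the j) 0)) + e"
    using vanishing_imp_in_span[of "range Some" "\<lambda>j x. u (the j) x + u (the j) 0" f None] by auto
  have "f x = (\<Sum>b\<in>UNIV. c (Some b) * u b x) + ((\<Sum>b\<in>UNIV. c (Some b) * u b 0) + e)" for x
    unfolding * by (simp add: sum.reindex distrib_left sum.distrib add.assoc)
  then show ?thesis by (intro exI allI)
qed

text \<open>The annihilator of each direction space consists of the combinations of the two linear
  parts of its product. Since these two are independent, directness of the sum of the annihilators
  amounts to independence of all 2k linear parts.\<close>

lemma short_sets_of_defect_eq: "short_sets_of_defect k = short_class k"
proof (intro equalityI subsetI)
  fix X :: "(bit ^ 'd) set"
  assume "X \<in> short_class k"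
  then obtain u where u: "affine_system (pairs k) u" and X: "X = {x. quad {1..k} (\<lambda>j. u j x) = 1}"
    unfolding short_class_def by (rule affine_classE)
  define S where "S i = {x. u (i, False) x * u (i, True) x = 1}" for i
  have ui: "affine_system UNIV (\<lambda>b. u (i, b))" if "i \<in> {1..k}" for i
    by (rule affine_system_reindex[OF u]) (use that in \<open>auto simp: inj_on_def\<close>)
  have "affine_subspace_codim 2 (S i)" if "i \<in> {1..k}" for i
    unfolding S_def by (rule codim_2_of_product[OF ui[OF that]])
  moreover have "X = boolean_sum S k"
    unfolding X quad_def by (rule boolean_sum_indicator[symmetric]) (simp add: S_def)
  moreover have "affinely_coindependent {1..k} S"
  proof -
    \<comment> \<open>A point where every factor is 1 lies in all the subspaces and serves as
      origin.\<close>
    obtain p where p: "\<And>j. j \<in> pairs k \<Longrightarrow> u j p = 1"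
      using affine_system_surj[OF u, of "\<lambda>_. 1"] by metis
    have pS: "p \<in> S i" if "i \<in> {1..k}" for i
      using p that by (simp add: S_def)
    have "coindependent {1..k} (\<lambda>i. (\<lambda>x. x - p) ` S i)"
      unfolding coindependent_def
    proof (intro allI impI, elim conjE)
      fix f :: "nat \<Rightarrow> bit ^ 'd \<Rightarrow> bit"
      assume f: "\<forall>i\<in>{1..k}. f i \<in> annihilator ((\<lambda>x. x - p) ` S i)"
        and sum: "\<forall>x. (\<Sum>i = 1..k. f i x) = 0"
      have "\<exists>c e. \<forall>x. f i x = (\<Sum>b\<in>UNIV. c b * u (i, b) x) + e" if "i \<in> {1..k}" for i
      proof (rule annihilator_direction_space[OF ui[OF that]])
        show "f i \<in> annihilator {x. \<forall>b. u (i, b) x = u (i, b) 0}"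
          using f[rule_format, OF that] pS[OF that] unfolding S_def
          by (simp only: product_direction_space[OF ui[OF that]])
      qed
      then obtain c e where c: "\<And>i x. i \<in> {1..k} \<Longrightarrow> f i x = (\<Sum>b\<in>UNIV. c i b * u (i, b) x) + e i"
        by metis
      \<comment> \<open>Expanding every \<open>f i\<close> in its two factors turns the vanishing
        sum into a relation between all factors, up to a constant.\<close>
      have "(\<Sum>j\<in>pairs k. c (fst j) (snd j) * u j x) = (\<Sum>i = 1..k. e i)" for x
      proof -
        have "0 = (\<Sum>i = 1..k. (\<Sum>b\<in>UNIV. c i b * u (i, b) x) + e i)"
          using sum[rule_format, of x] c by simp
        also have "\<dots> = (\<Sum>j\<in>pairs k. c (fst j) (snd j) * u j x) + (\<Sum>i = 1..k. e i)"
          by (simp add: sum.distrib sum.cartesian_product')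
        finally show ?thesis by (metis bit_add_eq_0_iff)
      qed
      then have c0: "c i b = 0" if "i \<in> {1..k}" for i b
        using affine_system_zero[OF u, of "\<lambda>j. c (fst j) (snd j)" _ "(i, b)"] that by simp
      have "f i x = 0" if "i \<in> {1..k}" for i x
      proof -
        have "f i 0 = 0" using f that by (simp add: annihilator_def linear_iff_affine_fun)
        then show ?thesis using c[OF that] c0[OF that] by simp
      qed
      then show "\<forall>i\<in>{1..k}. \<forall>x. f i x = 0" by blast
    qed
    then show ?thesis unfolding affinely_coindependent_def using pS by blast
  qed
  ultimately show "X \<in> short_sets_of_defect k"
    unfolding short_sets_of_defect_def by blast
next
  fix X :: "(bit ^ 'd) set"
  assume "X \<in> short_sets_of_defect k"
  then obtain S where S: "\<forall>i\<in>{1..k}. affine_subspace_codim 2 (S i)"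
      "affinely_coindependent {1..k} S" "X = boolean_sum S k"
    unfolding short_sets_of_defect_def by blast
  have "\<exists>u. affine_system (UNIV :: bool set) u \<and> S i = {x. u False x * u True x = 1}"
    if "i \<in> {1..k}" for i
    using codim_2_product[OF S(1)[rule_format, OF that]] by metis
  then obtain u where ui: "\<And>i. i \<in> {1..k} \<Longrightarrow> affine_system (UNIV :: bool set) (u i)"
      and Si: "\<And>i. i \<in> {1..k} \<Longrightarrow> S i = {x. u i False x * u i True x = 1}"
    by metis
  obtain p where "p \<in> (\<Inter>i\<in>{1..k}. S i)"
      and co: "coindependent {1..k} (\<lambda>i. (\<lambda>x. x - p) ` S i)"
    using S(2) unfolding affinely_coindependent_def by blast
  then have p: "p \<in> S i" if "i \<in> {1..k}" for i using that by blast
  define U where "U j = u (fst j) (snd j)" for j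
  have aff: "affine_fun (u i b)" if "i \<in> {1..k}" for i b
    using affine_systemD(3)[OF ui[OF that]] by simp
  have "affinely_independent (pairs k) U"
    unfolding affinely_independent_def
  proof (intro allI impI ballI)
    fix c e j
    assume rel: "\<forall>x. (\<Sum>j\<in>pairs k. c j * U j x) = e" and j: "j \<in> pairs k"
    \<comment> \<open>A relation between all factors is grouped by product. The linear part of each
      group lies in the annihilator for that product, so coindependence makes it zero.\<close>
    define f where "f i x = (\<Sum>b\<in>UNIV. c (i, b) * (u i b x + u i b 0))" for i x
    have "f i \<in> annihilator ((\<lambda>x. x - p) ` S i)" if i: "i \<in> {1..k}" for i
    proof -
      have "affine_fun (f i)"
        unfolding f_def using aff[OF i] by (intro affine_fun_sum affine_fun_cmult affine_fun_add) auto
      moreover have "f i x = 0" if "x \<in> {x. \<forall>b. u i b x = u i b 0}" for x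
        using that by (simp add: f_def)
      moreover have "f i 0 = 0" by (simp add: f_def)
      ultimately show ?thesis
        using product_direction_space[OF ui[OF i]] p[OF i]
        unfolding Si[OF i] annihilator_def linear_iff_affine_fun by simp
    qed
    moreover have "(\<Sum>i = 1..k. f i x) = 0" for x
    proof -
      have "(\<Sum>i = 1..k. f i x) = (\<Sum>j\<in>pairs k. c j * U j x) + (\<Sum>j\<in>pairs k. c j * U j 0)"
        by (simp add: f_def U_def sum.cartesian_product' distrib_left sum.distrib)
      then show ?thesis using rel by simp
    qed
    ultimately have f0: "f i x = 0" if "i \<in> {1..k}" for i x
      using co that unfolding coindependent_def by blast
    obtain i b where ib: "j = (i, b)" "i \<in> {1..k}" using j by (cases j) auto
    \<comment> \<open>What remains is a relation between the two factors of one product, which are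
      independent.\<close>
    have "(\<Sum>b\<in>UNIV. c (i, b) * u i b x) = (\<Sum>b\<in>UNIV. c (i, b) * u i b 0)" for x
      using f0[OF ib(2), of x] by (simp only: f_def distrib_left sum.distrib bit_add_eq_0_iff)
    then have "c (i, b) = 0"
      by (rule affine_system_zero[OF ui[OF ib(2)], where c = "\<lambda>b. c (i, b)"]) simp
    then show "c j = 0" by (simp add: ib)
  qed
  then have "affine_system (pairs k) U"
    using aff by (auto simp: affine_system_def U_def)
  moreover have "X = {x. quad {1..k} (\<lambda>j. U j x) = 1}"
    unfolding S(3) quad_def U_def by (rule boolean_sum_indicator) (simp add: Si)
  ultimately show "X \<in> short_class k"
    unfolding short_class_def using affine_classI[of "pairs k" U "\<lambda>f. quad {1..k} f = 1"] by simp
qed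

lemma long_sets_of_defect_eq: "long_sets_of_defect k = long_class k"
  unfolding long_sets_of_defect_def long_class_eq short_sets_of_defect_eq ..

section \<open>Classification of the orbits\<close>

text \<open>With no products only the extra coordinate is left. Treating hyperplanes as defect 0
  lets them share the orbit and uniqueness lemmas of the other midsets.\<close>

lemma affine_hyperplane_eq_mid_class: "Collect affine_hyperplane = mid_class 0"
proof -
  have "affine_hyperplane X \<longleftrightarrow> X \<in> mid_class 0" for X :: "(bit ^ 'd) set"
    unfolding affine_hyperplane_def mid_class_def
    using affine_subspace_codim_iff_class[of "{(0 :: nat, False)}" 1 X] by (simp add: quad_def)
  then show ?thesis by blast
qed

lemma affine_hyperplane_cases:
  assumes "affine_hyperplane H"
  obtains h where "affine_system {(0 :: nat, False)} (\<lambda>_. h)" "H = {x. h x = 1}"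
proof -
  have "H \<in> mid_class 0" using assms affine_hyperplane_eq_mid_class by blast
  then obtain u where "affine_system {(0 :: nat, False)} u" "H = {x. u (0, False) x = 1}"
    unfolding mid_class_def by (auto simp: quad_def elim: affine_classE)
  moreover from this have "affine_system {(0 :: nat, False)} (\<lambda>_. u (0, False))"
    by (subst affine_system_cong[where v = u]) auto
  ultimately show thesis by (intro that)
qed

text \<open>Supplies the short set and the hyperplane required in
  \<open>nonaffine_midsets_of_defect\<close>.\<close>

lemma mid_class_decompose:
  assumes "X \<in> mid_class k"
  obtains u h where "affine_system (pairs k) u" "affine_fun h"
    "X = sym_diff {x. quad {1..k} (\<lambda>j. u j x) = 1} {x. h x = 1}"
    "affine_hyperplane {x. h x = 1}"
proof -
  obtain u where u: "affine_system (insert (0, False) (pairs k)) u"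
    and X: "X = {x. quad {1..k} (\<lambda>j. u j x) + u (0, False) x = 1}"
    using assms unfolding mid_class_def by (rule affine_classE)
  have "affine_system {(0, False)} u" by (rule affine_system_subset[OF u]) simp
  then have "{x. u (0, False) x = 1} \<in> mid_class 0"
    using affine_classI[of "{(0 :: nat, False)}" u "\<lambda>f. quad {1..0} f + f (0, False) = 1"]
    by (simp add: mid_class_def quad_def)
  then have "affine_hyperplane {x. u (0, False) x = 1}"
    using affine_hyperplane_eq_mid_class by blast
  moreover have "affine_system (pairs k) u" by (rule affine_system_subset[OF u]) auto
  moreover have "affine_fun (u (0, False))" using affine_systemD(3)[OF u] by simp
  ultimately show thesis using X unfolding sym_diff_indicator[symmetric] by (intro that)
qed

section \<open>Separation of the classes and uniqueness of the defect\<close>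

lemma short_class_short: "X \<in> short_class k \<Longrightarrow> short X"
  using card_short_class(1)[of X k] unfolding short_def by (metis less_add_same_cancel1 zero_less_power zero_less_numeral)

lemma long_class_long: "X \<in> long_class k \<Longrightarrow> long X"
  using card_long_class(1)[of X k] unfolding long_def by simp

lemma mid_class_midset: "X \<in> mid_class k \<Longrightarrow> midset X"
  using card_mid_class(1)[of X k] unfolding midset_def by simp

lemma short_long_midset_disjoint:
  "short X \<Longrightarrow> \<not> long X" "short X \<Longrightarrow> \<not> midset X" "long X \<Longrightarrow> \<not> midset X"
  unfolding short_def long_def midset_def by auto

text \<open>The cardinality decides which alternative of \<open>RM2_cases\<close> can occur.\<close>

lemma short_RM2_class: "X \<in> RM2 \<Longrightarrow> short X \<Longrightarrow> \<exists>k. X \<in> short_class k"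
  by (metis RM2_cases UnE long_class_long mid_class_midset short_long_midset_disjoint)

lemma long_RM2_class: "X \<in> RM2 \<Longrightarrow> long X \<Longrightarrow> \<exists>k. X \<in> long_class k"
  by (metis RM2_cases UnE short_class_short mid_class_midset short_long_midset_disjoint)

lemma midset_RM2_class: "X \<in> RM2 \<Longrightarrow> midset X \<Longrightarrow> \<exists>k. X \<in> mid_class k"
  by (metis RM2_cases UnE short_class_short long_class_long short_long_midset_disjoint)

lemma short_class_defect_unique:
  fixes X Y :: "(bit ^ 'd) set"
  assumes d: "CARD('d) \<ge> 2" and X: "X \<in> short_class k" and Y: "Y \<in> short_class l"
    and card: "card X = card Y"
  shows "k = l"
proof -
  have "2 ^ (CARD('d) - k - 1) = (2 :: nat) ^ (CARD('d) - l - 1)"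
    using card_short_class(1)[OF X] card_short_class(1)[OF Y] card by linarith
  then have "CARD('d) - k - 1 = CARD('d) - l - 1" by simp
  then show ?thesis using card_short_class(2)[OF X] card_short_class(2)[OF Y] d by linarith
qed

lemma long_class_defect_unique:
  fixes X :: "(bit ^ 'd) set"
  assumes "CARD('d) \<ge> 2" "X \<in> long_class k" "X \<in> long_class l"
  shows "k = l"
proof -
  have "- X \<in> short_class k" "- X \<in> short_class l" using assms by (auto simp: long_class_eq)
  then show ?thesis using short_class_defect_unique[OF assms(1)] by blast
qed

text \<open>
  Two mid representations differ by an affine function, so the quadratic part of one is a short
  set obtained from the quadratic part of the other by adding an affine function; its cardinality
  determines the defect.
\<close>

lemma mid_class_defect_unique:
  fixes X :: "(bit ^ 'd) set"
  assumes d: "CARD('d) \<ge> 2" and k: "X \<in> mid_class k" and l: "X \<in> mid_class l"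
  shows "k = l"
proof -
  obtain u h where u: "affine_system (pairs k) u" "affine_fun h"
      "X = sym_diff {x. quad {1..k} (\<lambda>j. u j x) = 1} {x. h x = 1}"
    by (rule mid_class_decompose[OF k])
  obtain v g where v: "affine_system (pairs l) v" "affine_fun g"
      "X = sym_diff {x. quad {1..l} (\<lambda>j. v j x) = 1} {x. g x = 1}"
    by (rule mid_class_decompose[OF l])
  let ?S = "{x. quad {1..l} (\<lambda>j. v j x) = 1}"
  have "?S = sym_diff X {x. g x = 1}" using v(3) by blast
  also have "\<dots> = {x. quad {1..k} (\<lambda>j. u j x) + (h x + g x) = 1}"
    unfolding u(3) sym_diff_indicator by (simp add: add.assoc)
  finally have S: "?S \<in> short_class k \<union> long_class k \<union> mid_class k"
    using quad_absorb_affine[OF u(1) affine_fun_add[OF u(2) v(2)]] by simp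
  have Sl: "?S \<in> short_class l"
    unfolding short_class_def using affine_classI[OF v(1), of "\<lambda>f. quad {1..l} f = 1"] by simp
  then have "short ?S" by (rule short_class_short)
  then have "?S \<in> short_class k"
    using S long_class_long mid_class_midset short_long_midset_disjoint by blast
  then show ?thesis using short_class_defect_unique[OF d _ Sl] by blast
qed

text \<open>The definition prescribes only the cardinality of \<open>S\<close>, but this determines
  its defect. Conversely, uniqueness of the defect excludes hyperplanes, whose defect is 0 while k
  is at least 1.\<close>

lemma nonaffine_midsets_of_defect_eq:
  assumes d: "CARD('d) \<ge> 2" and k: "k \<in> {1..(CARD('d) - 1) div 2}"
  shows "nonaffine_midsets_of_defect k = (mid_class k :: (bit ^ 'd) set set)"
proof (intro equalityI subsetI)
  fix X :: "(bit ^ 'd) set"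
  assume X: "X \<in> mid_class k"
  obtain u h where u: "affine_system (pairs k) u" "affine_fun h"
      "X = sym_diff {x. quad {1..k} (\<lambda>j. u j x) = 1} {x. h x = 1}"
      "affine_hyperplane {x. h x = 1}"
    by (rule mid_class_decompose[OF X])
  let ?S = "{x. quad {1..k} (\<lambda>j. u j x) = 1}"
  have S: "?S \<in> short_class k"
    unfolding short_class_def using affine_classI[OF u(1), of "\<lambda>f. quad {1..k} f = 1"] by simp
  have "card ?S = 2 ^ (CARD('d) - 1) - 2 ^ (CARD('d) - k - 1)"
    using card_short_class(1)[OF S] by (metis diff_add_inverse2)
  moreover have "\<not> affine_hyperplane X"
    using mid_class_defect_unique[OF d X, of 0] k affine_hyperplane_eq_mid_class by auto
  moreover have "?S \<in> RM2" "short ?S" using S short_class_RM2 short_class_short by blast+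
  moreover have "X \<in> RM2" "midset X"
    using X mid_class_RM2[OF d] mid_class_midset by blast+
  ultimately show "X \<in> nonaffine_midsets_of_defect k"
    unfolding nonaffine_midsets_of_defect_def using u(3,4) by blast
next
  fix X :: "(bit ^ 'd) set"
  assume "X \<in> nonaffine_midsets_of_defect k"
  then obtain S H where X: "midset X" "X = sym_diff S H" and S: "S \<in> RM2" "short S"
      "card S = 2 ^ (CARD('d) - 1) - 2 ^ (CARD('d) - k - 1)" and H: "affine_hyperplane H"
    unfolding nonaffine_midsets_of_defect_def by blast
  obtain l where l: "S \<in> short_class l" using short_RM2_class[OF S(1,2)] by blast
  \<comment> \<open>Ensures that the subtraction in the prescribed cardinality is not
    truncated.\<close>
  have "(2 :: nat) ^ (CARD('d) - k - 1) \<le> 2 ^ (CARD('d) - 1)" by (rule power_increasing) auto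
  then have "2 ^ (CARD('d) - k - 1) = (2 :: nat) ^ (CARD('d) - l - 1)"
    using card_short_class(1)[OF l] S(3) by linarith
  then have "CARD('d) - k - 1 = CARD('d) - l - 1" by simp
  then have "l = k" using card_short_class(2)[OF l] k d by auto
  then obtain u where u: "affine_system (pairs k) u" "S = {x. quad {1..k} (\<lambda>j. u j x) = 1}"
    using l unfolding short_class_def by (auto elim: affine_classE)
  obtain h where h: "affine_system {(0 :: nat, False)} (\<lambda>_. h)" "H = {x. h x = 1}"
    using affine_hyperplane_cases[OF H] by metis
  \<comment> \<open>The hyperplane may depend on the factors of \<open>S\<close>; the sum is then
    short or long, which the midset hypothesis rules out.\<close>
  have "X \<in> short_class k \<union> long_class k \<union> mid_class k"
    unfolding X(2) u(2) h(2) sym_diff_indicator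
    using quad_absorb_affine[OF u(1)] affine_systemD(3)[OF h(1)] by simp
  then show "X \<in> mid_class k"
    using X(1) short_class_short long_class_long short_long_midset_disjoint by blast
qed

section \<open>The complete list of orbits\<close>

lemma depends_only_on_quad:
  "depends_only_on (pairs k) (\<lambda>f. quad {1..k} f = 1)"
  "depends_only_on (pairs k) (\<lambda>f. quad {1..k} f \<noteq> 1)"
  "depends_only_on (insert (0, False) (pairs k)) (\<lambda>f. quad {1..k} f + f (0, False) = 1)"
proof -
  have "quad {1..k} f = quad {1..k} g" if "\<forall>j\<in>pairs k. f j = g j" for f g
    using that by (intro quad_cong) auto
  then show "depends_only_on (pairs k) (\<lambda>f. quad {1..k} f = 1)"
    "depends_only_on (pairs k) (\<lambda>f. quad {1..k} f \<noteq> 1)"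
    "depends_only_on (insert (0, False) (pairs k)) (\<lambda>f. quad {1..k} f + f (0, False) = 1)"
    unfolding depends_only_on_def by (metis insertCI)+
qed

lemma class_orbits:
  fixes k :: nat
  assumes d: "CARD('d) \<ge> 2"
  shows "2 * k \<le> CARD('d) \<Longrightarrow> (short_class k :: (bit ^ 'd) set set) \<in> orbits AGL RM2 AGL_action"
    and "2 * k \<le> CARD('d) \<Longrightarrow> (long_class k :: (bit ^ 'd) set set) \<in> orbits AGL RM2 AGL_action"
    and "2 * k + 1 \<le> CARD('d) \<Longrightarrow> (mid_class k :: (bit ^ 'd) set set) \<in> orbits AGL RM2 AGL_action"
proof -
  have card: "card (pairs k) = 2 * k" "card (insert (0, False) (pairs k)) = 2 * k + 1"
    by (simp_all add: card_cartesian_product)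
  show "short_class k \<in> orbits AGL (RM2 :: (bit ^ 'd) set set) AGL_action" if "2 * k \<le> CARD('d)"
    using short_class_RM2 that unfolding short_class_def card[symmetric]
    by (intro affine_class_orbit depends_only_on_quad) auto
  show "long_class k \<in> orbits AGL (RM2 :: (bit ^ 'd) set set) AGL_action" if "2 * k \<le> CARD('d)"
    using long_class_RM2[OF d] that unfolding long_class_def card[symmetric]
    by (intro affine_class_orbit depends_only_on_quad) auto
  show "mid_class k \<in> orbits AGL (RM2 :: (bit ^ 'd) set set) AGL_action" if "2 * k + 1 \<le> CARD('d)"
    using mid_class_RM2[OF d] that unfolding mid_class_def card[symmetric]
    by (intro affine_class_orbit depends_only_on_quad) auto
qed

lemma class_nonempty:
  fixes k :: nat
  shows "2 * k \<le> CARD('d) \<Longrightarrow> (short_class k :: (bit ^ 'd) set set) \<noteq> {}"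
    and "2 * k \<le> CARD('d) \<Longrightarrow> (long_class k :: (bit ^ 'd) set set) \<noteq> {}"
    and "2 * k + 1 \<le> CARD('d) \<Longrightarrow> (mid_class k :: (bit ^ 'd) set set) \<noteq> {}"
  unfolding short_class_def long_class_def mid_class_def
  by (rule affine_class_nonempty; simp add: card_cartesian_product)+

text \<open>Every orbit meets some class, that class is itself an orbit, and orbits that meet
  coincide. The cardinality lemmas bound k.\<close>

lemma orbits_RM2:
  assumes d: "CARD('d) \<ge> 2"
  shows "orbits AGL (RM2 :: (bit ^ 'd) set set) AGL_action =
    short_class ` {0..CARD('d) div 2} \<union> long_class ` {0..CARD('d) div 2} \<union>
    mid_class ` {0..(CARD('d) - 1) div 2}" (is "?O = ?C")
proof (intro equalityI subsetI)
  fix \<Omega> :: "(bit ^ 'd) set set"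
  assume \<Omega>: "\<Omega> \<in> ?O"
  interpret group_action "AGL :: (bit ^ 'd \<Rightarrow> bit ^ 'd) monoid" RM2 AGL_action
    by (rule group_action_AGL)
  obtain X where X: "X \<in> RM2" "\<Omega> = orbit AGL AGL_action X" using \<Omega> by (auto simp: orbits_def)
  then have "X \<in> \<Omega>" using orbit_refl by simp
  then have eq: "\<Omega> = \<Gamma>" if "X \<in> \<Gamma>" "\<Gamma> \<in> ?O" for \<Gamma>
    using disjoint_union[OF \<Omega> that(2)] that(1) by blast
  obtain k where k: "X \<in> short_class k \<union> long_class k \<union> mid_class k"
    using RM2_cases[OF X(1)] by blast
  consider "X \<in> short_class k" | "X \<in> long_class k" | "X \<in> mid_class k" using k by blast
  then show "\<Omega> \<in> ?C"
  proof cases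
    case 1
    then have "2 * k \<le> CARD('d)" by (rule card_short_class)
    then have "\<Omega> = short_class k" "k \<in> {0..CARD('d) div 2}"
      using eq[OF 1] class_orbits(1)[OF d] by auto
    then show ?thesis by blast
  next
    case 2
    then have "2 * k \<le> CARD('d)" by (rule card_long_class)
    then have "\<Omega> = long_class k" "k \<in> {0..CARD('d) div 2}"
      using eq[OF 2] class_orbits(2)[OF d] by auto
    then show ?thesis by blast
  next
    case 3
    then have "2 * k + 1 \<le> CARD('d)" by (rule card_mid_class)
    then have "\<Omega> = mid_class k" "k \<in> {0..(CARD('d) - 1) div 2}"
      using eq[OF 3] class_orbits(3)[OF d] by auto
    then show ?thesis by blast
  qed
next
  fix \<Omega> :: "(bit ^ 'd) set set"
  assume "\<Omega> \<in> ?C"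
  then show "\<Omega> \<in> ?O"
  proof (elim UnE imageE; clarify)
    fix k assume "k \<in> {0..(CARD('d) - 1) div 2}"
    then have "2 * k + 1 \<le> CARD('d)" using d by auto
    then show "mid_class k \<in> ?O" by (rule class_orbits[OF d])
  qed (auto intro!: class_orbits[OF d])
qed

theorem theorem1p1:
  fixes d :: nat and RM :: "(bit ^ 'd) set set" and Orb :: "(bit ^ 'd) set set set"
  assumes d: "d = CARD('d)" and "d \<ge> 2"
    and RM: "RM = RM2"
    and Orb: "Orb = orbits AGL RM AGL_action"
  shows
    "Orb = short_sets_of_defect ` {0..d div 2} \<union> long_sets_of_defect ` {0..d div 2}
         \<union> {Collect affine_hyperplane} \<union> nonaffine_midsets_of_defect ` {1..(d - 1) div 2} \<and>

     (bij_betw short_sets_of_defect {0..d div 2} {\<Omega> \<in> Orb. \<forall>X\<in>\<Omega>. short X} \<and>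
      (\<forall>X. X \<in> RM \<and> short X \<longleftrightarrow> (\<exists>k\<in>{0..d div 2}. X \<in> short_sets_of_defect k)) \<and>
      (\<forall>k\<in>{0..d div 2}. \<forall>X \<in> (short_sets_of_defect k :: (bit ^ 'd) set set).
           card X = 2 ^ (d - 1) - 2 ^ (d - k - 1))) \<and>

     (bij_betw long_sets_of_defect {0..d div 2} {\<Omega> \<in> Orb. \<forall>X\<in>\<Omega>. long X} \<and>
      (\<forall>X. X \<in> RM \<and> long X \<longleftrightarrow> (\<exists>k\<in>{0..d div 2}. X \<in> long_sets_of_defect k))) \<and>

     ({\<Omega> \<in> Orb. \<forall>X\<in>\<Omega>. midset X \<and> affine_hyperplane X} = {Collect affine_hyperplane} \<and>
      (\<forall>X :: (bit ^ 'd) set. affine_hyperplane X \<longrightarrow> X \<in> RM \<and> midset X) \<and>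
      bij_betw nonaffine_midsets_of_defect {1..(d - 1) div 2}
        {\<Omega> \<in> Orb. \<forall>X\<in>\<Omega>. midset X \<and> \<not> affine_hyperplane X} \<and>
      (\<forall>X\<in>RM. midset X \<longrightarrow> affine_hyperplane X \<or>
         (\<exists>!k. k \<in> {1..(d - 1) div 2} \<and> X \<in> nonaffine_midsets_of_defect k)))"
proof -
  let ?D = "{0..d div 2}" and ?M = "{1..(d - 1) div 2}"
  have d2: "CARD('d) \<ge> 2" using assms by simp
  have SL: "(short_sets_of_defect :: nat \<Rightarrow> (bit ^ 'd) set set) = short_class"
      "(long_sets_of_defect :: nat \<Rightarrow> (bit ^ 'd) set set) = long_class"
    using short_sets_of_defect_eq long_sets_of_defect_eq by blast+
  have N: "nonaffine_midsets_of_defect k = (mid_class k :: (bit ^ 'd) set set)" if "k \<in> ?M" for k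
    using nonaffine_midsets_of_defect_eq[OF d2] that d by simp
  have hyper: "affine_hyperplane X \<longleftrightarrow> X \<in> mid_class 0" for X :: "(bit ^ 'd) set"
    using affine_hyperplane_eq_mid_class by blast
  have M0: "{0..(d - 1) div 2} = insert 0 ?M" by auto
  have orbits: "Orb = short_class ` ?D \<union> long_class ` ?D \<union> {mid_class 0} \<union> mid_class ` ?M"
    using orbits_RM2[OF d2] unfolding Orb RM d[symmetric] M0 by auto
  have neS: "(short_class k :: (bit ^ 'd) set set) \<noteq> {}" "(long_class k :: (bit ^ 'd) set set) \<noteq> {}"
    if "k \<in> ?D" for k
    using class_nonempty(1,2)[of k, where 'd = 'd] that unfolding d by auto
  have neM: "(mid_class k :: (bit ^ 'd) set set) \<noteq> {}" if "k \<in> insert 0 ?M" for k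
  proof (rule class_nonempty)
    show "2 * k + 1 \<le> CARD('d)" using that d2 unfolding d by auto
  qed
  have nonaffine: "\<not> affine_hyperplane X" if "X \<in> mid_class k" "k \<in> ?M" for X :: "(bit ^ 'd) set" and k
    using mid_class_defect_unique[OF d2 that(1), of 0] that(2) hyper by auto
  \<comment> \<open>An empty orbit would satisfy every condition of the form "for all its members"
    vacuously.\<close>
  have ne: "\<Omega> \<noteq> {}" if "\<Omega> \<in> Orb" for \<Omega>
    using that neS neM unfolding orbits by fast
  \<comment> \<open>Serves all four families at once: \<open>B\<close> is the wanted family and
    \<open>A\<close> the rest, no member of which has an element satisfying
    \<open>Q\<close>.\<close>
  have select: "{\<Omega> \<in> Orb. \<forall>X\<in>\<Omega>. Q X} = B"
    if "Orb = A \<union> B" "\<And>\<Omega> X. \<Omega> \<in> A \<Longrightarrow> X \<in> \<Omega> \<Longrightarrow> \<not> Q X" "\<And>\<Omega> X. \<Omega> \<in> B \<Longrightarrow> X \<in> \<Omega> \<Longrightarrow> Q X"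
    for A B and Q :: "(bit ^ 'd) set \<Rightarrow> bool"
  proof (intro equalityI subsetI)
    fix \<Omega> assume \<Omega>: "\<Omega> \<in> {\<Omega> \<in> Orb. \<forall>X\<in>\<Omega>. Q X}"
    then obtain X where "X \<in> \<Omega>" using ne by blast
    with \<Omega> have "\<Omega> \<notin> A" using that(2) by blast
    with \<Omega> show "\<Omega> \<in> B" using that(1) by blast
  qed (use that(1,3) in blast)
  note types = short_class_short long_class_long mid_class_midset short_long_midset_disjoint
  have S_orb: "{\<Omega> \<in> Orb. \<forall>X\<in>\<Omega>. short X} = short_class ` ?D"
  proof (rule select)
    show "Orb = (long_class ` ?D \<union> {mid_class 0} \<union> mid_class ` ?M) \<union> short_class ` ?D"
      unfolding orbits by blast
  qed (use types in fast)+
  have L_orb: "{\<Omega> \<in> Orb. \<forall>X\<in>\<Omega>. long X} = long_class ` ?D"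
  proof (rule select)
    show "Orb = (short_class ` ?D \<union> {mid_class 0} \<union> mid_class ` ?M) \<union> long_class ` ?D"
      unfolding orbits by blast
  qed (use types in fast)+
  have H_orb: "{\<Omega> \<in> Orb. \<forall>X\<in>\<Omega>. midset X \<and> affine_hyperplane X} = {mid_class 0}"
  proof (rule select)
    show "Orb = (short_class ` ?D \<union> long_class ` ?D \<union> mid_class ` ?M) \<union> {mid_class 0}"
      unfolding orbits by blast
  qed (use types nonaffine hyper in fast)+
  have N_orb: "{\<Omega> \<in> Orb. \<forall>X\<in>\<Omega>. midset X \<and> \<not> affine_hyperplane X} = mid_class ` ?M"
  proof (rule select)
    show "Orb = (short_class ` ?D \<union> long_class ` ?D \<union> {mid_class 0}) \<union> mid_class ` ?M"
      unfolding orbits by blast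
  qed (use types nonaffine hyper in fast)+
  have inj_S: "inj_on (short_class :: nat \<Rightarrow> (bit ^ 'd) set set) ?D"
    using neS(1) short_class_defect_unique[OF d2] by (intro inj_onI) blast
  have inj_L: "inj_on (long_class :: nat \<Rightarrow> (bit ^ 'd) set set) ?D"
    using neS(2) long_class_defect_unique[OF d2] by (intro inj_onI) blast
  have inj_M: "inj_on (mid_class :: nat \<Rightarrow> (bit ^ 'd) set set) ?M"
    using neM mid_class_defect_unique[OF d2] by (intro inj_onI) blast
  \<comment> \<open>The equality \<open>N\<close> is available only for indices in
    \<open>?M\<close>, so the bijection is transferred by congruence on that set.\<close>
  have bij_N: "bij_betw nonaffine_midsets_of_defect ?M (mid_class ` ?M :: (bit ^ 'd) set set set)"
    using inj_on_imp_bij_betw[OF inj_M] by (simp only: bij_betw_cong[OF N])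
  have S_iff: "X \<in> RM \<and> short X \<longleftrightarrow> (\<exists>k\<in>?D. X \<in> short_class k)" for X :: "(bit ^ 'd) set"
    unfolding RM
  proof
    assume "X \<in> RM2 \<and> short X"
    then obtain k where k: "X \<in> short_class k" using short_RM2_class by blast
    then have "k \<in> ?D" using card_short_class(2)[OF k] d by auto
    with k show "\<exists>k\<in>?D. X \<in> short_class k" by blast
  qed (use short_class_RM2 short_class_short in blast)
  have L_iff: "X \<in> RM \<and> long X \<longleftrightarrow> (\<exists>k\<in>?D. X \<in> long_class k)" for X :: "(bit ^ 'd) set"
    unfolding RM
  proof
    assume "X \<in> RM2 \<and> long X"
    then obtain k where k: "X \<in> long_class k" using long_RM2_class by blast
    then have "k \<in> ?D" using card_long_class(2)[OF k] d by auto
    with k show "\<exists>k\<in>?D. X \<in> long_class k" by blast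
  qed (use long_class_RM2[OF d2] long_class_long in blast)
  have S_card: "card X = 2 ^ (d - 1) - 2 ^ (d - k - 1)" if "X \<in> short_class k" for X :: "(bit ^ 'd) set" and k
    using card_short_class(1)[OF that] unfolding d by (metis diff_add_inverse2)
  have H_mid: "X \<in> RM \<and> midset X" if "affine_hyperplane X" for X :: "(bit ^ 'd) set"
    using that mid_class_RM2[OF d2] mid_class_midset unfolding RM hyper by blast
  have N_unique: "\<exists>!k. k \<in> ?M \<and> X \<in> nonaffine_midsets_of_defect k"
    if X: "X \<in> RM" "midset X" "\<not> affine_hyperplane X" for X :: "(bit ^ 'd) set"
  proof -
    obtain k where k: "X \<in> mid_class k" using midset_RM2_class X RM by blast
    have "k \<noteq> 0" using k X(3) hyper by metis
    then have "k \<in> ?M" using card_mid_class(2)[OF k] d by auto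
    show ?thesis
    proof (rule ex1I)
      show "k \<in> ?M \<and> X \<in> nonaffine_midsets_of_defect k" using \<open>k \<in> ?M\<close> k N by simp
      show "l = k" if "l \<in> ?M \<and> X \<in> nonaffine_midsets_of_defect l" for l
        using that N mid_class_defect_unique[OF d2 _ k] by metis
    qed
  qed
  then have N_all: "\<forall>X\<in>RM. midset X \<longrightarrow> affine_hyperplane X \<or>
      (\<exists>!k. k \<in> ?M \<and> X \<in> nonaffine_midsets_of_defect k)"
    by blast
  have N_image: "nonaffine_midsets_of_defect ` ?M = (mid_class ` ?M :: (bit ^ 'd) set set set)"
    using N by (rule image_cong[OF refl])
  show ?thesis
    unfolding SL affine_hyperplane_eq_mid_class S_orb L_orb H_orb N_orb N_image
    using orbits inj_S inj_L bij_N S_iff L_iff S_card H_mid N_all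
    by (simp add: bij_betw_def)
qed

end
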